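(* Let $\{G^N\}_N$ be an $f$-sequence with stepwise $f$ that is in the $\mathbf p$-subcritical regime, let $\boldsymbol\varepsilon\in\mathrm{Poly}(\mathbf p)$, and consider the sub-system $\tilde G^N(\mathbf p,\boldsymbol\varepsilon)$ constructed by the ICRD approach under the JIQ policy. In steady state, the probability that a new task is assigned to a busy server (the queueing probability) converges to $0$ as $N\to\infty$.
   Context: Notation: $[n]=\{1,\dots,n\}$. Model. $G^N=(\mathcal W^N,\mathcal V^N,\boldsymbol\lambda^N,\mathcal U^N)$ is a load balancing system with dispatchers $\mathcal W^N=\{1,\dots,W(N)\}$ (each dispatcher handles exactly one type of task, so dispatcher = task type) and servers $\mathcal V^N=\{1,\dots,N\}$. Each server has its own infinite-buffer queue served First-Come-First-Served. Tasks arrive at dispatcher $i$ as a Poisson process of rate $\lambda_i^N$, independently of everything else, and must be assigned immediately and irrevocably to a server. The service time of a type-$i$ task at server $j$ is exponential with mean $1/\mu^N_{i,j}$ if $\mu^N_{i,j}>0$ (all service times independent); if $\mu^N_{i,j}=0$ server $j$ cannot process type-$i$ tasks. $\mathcal U^N=(\mu^N_{i,j})$. $f$-sequence. There are fixed maps $\phi_1,\phi_2:\mathbb N\to[0,1)$ (for dispatchers and servers), and $f:[0,1)^2\to\mathbb R_+$; the sets $\mathcal W^N,\mathcal V^N$ are increasing in $N$, and $\mu^N_{i,j}=f(\phi_1(i),\phi_2(j))$ for all $(i,j)\in\mathcal W^N\times\mathcal V^N$. Stepwise $f$. There are partitions $0=w_0<\dots<w_H=1$ and $0=v_0<\dots<v_M=1$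 and constants $\mu_{h,m}\ge0$ with $f(x,y)=\mu_{h,m}$ for $(x,y)\in[w_{h-1},w_h)\times[v_{m-1},v_m)$. Put $\mathcal W^N_h=\{i\in\mathcal W^N:\phi_1(i)\in[w_{h-1},w_h)\}$ and $\mathcal V^N_m=\{j\in\mathcal V^N:\phi_2(j)\in[v_{m-1},v_m)\}$. $\mathbf p$-subcritical regime. (i) For each $h$, $\lim_N \frac1N\sum_{i\in\mathcal W^N_h}\lambda^N_i=\lambda_h>0$; (ii) for each $m$, $\lim_N|\mathcal V^N_m|/N=v_m-v_{m-1}$; (iii) $\mathbf p=(p_{h,m})\in[0,1]^{H\times M}$ has unit row sums and $\sum_{h\in[H]}\frac{\lambda_hp_{h,m}}{\mu_{h,m}(v_m-v_{m-1})}<1$ for all $m\in[M]$. Convention: a quotient with numerator $0$ is $0$, and one with positive numerator and zero denominator is $+\infty$ (so $p_{h,m}>0$ forces $\mu_{h,m}>0$). $\mathrm{Poly}(\mathbf p)$. Let $\varepsilon^*_m=(v_m-v_{m-1})-\sum_{h}\frac{\lambda_hp_{h,m}}{\mu_{h,m}}$. $\mathrm{Poly}(\mathbf p)$ is the set of $\boldsymbol\varepsilon=(\varepsilon_{h,m})\in[0,1)^{H\times M}$ such that for each $h$ one has $\varepsilon_{h,1}:\cdots:\varepsilon_{h,M}=p_{h,1}:\cdots:p_{h,M}$ (that is, $\varepsilon_{h,m}=c_hp_{h,m}$ for all $m$, for some $c_h>0$), and $\sum_h\varepsilon_{h,m}\le\varepsilon^*_m$ for every $m$. ICRD sub-system $\tilde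 G^N(\mathbf p,\boldsymbol\varepsilon)$. Each $\mathcal V^N_m$ is divided into disjoint sets $\mathcal V^N_{h,m}$, $h\in[H]$, with $|\mathcal V^N_{h,m}|=\lfloor N(\frac{\lambda_hp_{h,m}}{\mu_{h,m}}+\varepsilon_{h,m})\rfloor$, and a remainder $\mathcal V^N_{0,m}$ (the construction presupposes that $\mathcal V^N_m$ is large enough for such a division; this is understood for all sufficiently large $N$). It has the same dispatchers, servers and arrival rates as $G^N$; the service rate of type $i\in\mathcal W^N_h$ at server $j$ is $\mu_{h,m}$ if $j\in\mathcal V^N_{h,m}$, and is set to $0$ if $j\notin\bigcup_m\mathcal V^N_{h,m}$. JIQ policy in $\tilde G^N$. A task arriving at a dispatcher in $\mathcal W^N_h$ is assigned to a uniformly random idle server in $\bigcup_{m}\mathcal V^N_{h,m}$ if there is one, and otherwise to a uniformly random server of $\bigcup_m\mathcal V^N_{h,m}$. A server is busy if its queue (including the task in service) is non-empty, and idle otherwise. "In steady state" refers to the stationary regime of the system, for $N$ large. *)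

theory Defs
  imports "HOL-Probability.Probability"
begin

section \<open>Load balancing systems and their Markov process\<close>

record lb_system =
  dispatchers :: "nat set"
  servers :: "nat set"
  arr_rate :: "nat \<Rightarrow> real"
  srv_rate :: "nat \<Rightarrow> nat \<Rightarrow> real"

text \<open>
  \<open>x j\<close> is the FCFS queue of server \<open>j\<close>: the list of the types of its tasks in order of arrival,
  the head being the task in service.
\<close>

type_synonym state = "nat \<Rightarrow> nat list"

text \<open>
  An assignment policy: \<open>A i x\<close> is the law of the server to which a task arriving at dispatcher \<open>i\<close>
  is sent when the system is in state \<open>x\<close>.
\<close>

type_synonym policy = "nat \<Rightarrow> state \<Rightarrow> nat pmf"

definition busy :: "state \<Rightarrow> nat \<Rightarrow> bool" where
  "busy x j \<longleftrightarrow> x j \<noteq> []"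

text \<open>
  Queues contain only existing tasks which their server can process. Other states cannot be
  reached; a server holding a task of rate \<open>0\<close> at its head would be blocked forever.
\<close>

definition states :: "lb_system \<Rightarrow> state set" where
  "states G = {x. (\<forall>j. j \<notin> servers G \<longrightarrow> x j = []) \<and>
     (\<forall>j \<in> servers G. \<forall>i \<in> set (x j). i \<in> dispatchers G \<and> srv_rate G i j > 0)}"

text \<open>
  The process is driven by independent Poisson clocks: \<open>Arrival i\<close> rings at rate \<open>\<lambda>\<^sub>i\<close> and is a task
  arriving at dispatcher \<open>i\<close>; \<open>Service i j\<close> rings at rate \<open>\<mu>\<^sub>i\<^sub>j\<close> and completes the task in service
  at \<open>j\<close> if that task has type \<open>i\<close>, and has no effect otherwise. Hence a type \<open>i\<close> task at server
  \<open>j\<close> has an exponential service time with mean \<open>1 / \<mu>\<^sub>i\<^sub>j\<close>, independent of everything else.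
\<close>

datatype event = Arrival nat | Service nat nat

definition events :: "lb_system \<Rightarrow> event set" where
  "events G = Arrival ` dispatchers G \<union> (\<lambda>(i, j). Service i j) ` (dispatchers G \<times> servers G)"

fun event_rate :: "lb_system \<Rightarrow> event \<Rightarrow> real" where
  "event_rate G (Arrival i) = arr_rate G i"
| "event_rate G (Service i j) = srv_rate G i j"

definition total_rate :: "lb_system \<Rightarrow> real" where
  "total_rate G = (\<Sum>e\<in>events G. event_rate G e)"

text \<open>
  The laws defined below through \<^const>\<open>embed_pmf\<close> and \<^const>\<open>poisson_pmf\<close> are meaningful only if
  the total (arrival) rate is positive.
\<close>

definition event_pmf :: "lb_system \<Rightarrow> event pmf" where
  "event_pmf G = embed_pmf (\<lambda>e. if e \<in> events G then event_rate G e / total_rate G else 0)"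

fun apply_event :: "policy \<Rightarrow> event \<Rightarrow> state \<Rightarrow> state pmf" where
  "apply_event A (Arrival i) x = map_pmf (\<lambda>j. x(j := x j @ [i])) (A i x)"
| "apply_event A (Service i j) x =
     return_pmf (if x j \<noteq> [] \<and> hd (x j) = i then x(j := tl (x j)) else x)"

definition step :: "lb_system \<Rightarrow> policy \<Rightarrow> state \<Rightarrow> state pmf" where
  "step G A x = bind_pmf (event_pmf G) (\<lambda>e. apply_event A e x)"

text \<open>
  The transition function \<open>P\<^sub>t(x, \<cdot>)\<close> of the continuous-time Markov process: the number of clock rings
  up to time \<open>t\<close> is Poisson with mean \<open>t\<close> times the total rate, and the rings are i.i.d. events.
\<close>

definition transition :: "lb_system \<Rightarrow> policy \<Rightarrow> real \<Rightarrow> state \<Rightarrow> state pmf" where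
  "transition G A t x = bind_pmf (poisson_pmf (total_rate G * t))
     (\<lambda>n. ((\<lambda>D. bind_pmf D (step G A)) ^^ n) (return_pmf x))"

definition steady_state :: "lb_system \<Rightarrow> policy \<Rightarrow> state pmf \<Rightarrow> bool" where
  "steady_state G A \<pi> \<longleftrightarrow>
     set_pmf \<pi> \<subseteq> states G \<and> (\<forall>t>0. bind_pmf \<pi> (transition G A t) = \<pi>)"

definition new_task_pmf :: "lb_system \<Rightarrow> nat pmf" where
  "new_task_pmf G = embed_pmf (\<lambda>i. if i \<in> dispatchers G
     then arr_rate G i / (\<Sum>i\<in>dispatchers G. arr_rate G i) else 0)"

text \<open>
  The arrivals are Poisson processes independent of the past of the system, so a new task finds the
  system in its stationary law \<open>\<pi>\<close> (independently of its type), and its type is distributed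
  proportionally to the arrival rates.
\<close>

definition queueing_prob :: "lb_system \<Rightarrow> policy \<Rightarrow> state pmf \<Rightarrow> real" where
  "queueing_prob G A \<pi> = measure_pmf.prob
     (bind_pmf \<pi> (\<lambda>x. bind_pmf (new_task_pmf G) (\<lambda>i. map_pmf (\<lambda>j. (x, j)) (A i x))))
     {(x, j). busy x j}"


section \<open>Sequences of systems with a stepwise rate function\<close>

definition f_sequence ::
  "(real \<Rightarrow> real \<Rightarrow> real) \<Rightarrow> (nat \<Rightarrow> real) \<Rightarrow> (nat \<Rightarrow> real) \<Rightarrow> (nat \<Rightarrow> lb_system) \<Rightarrow> bool" where
  "f_sequence f \<phi>1 \<phi>2 G \<longleftrightarrow>
     (\<forall>i. \<phi>1 i \<in> {0..<1}) \<and> (\<forall>j. \<phi>2 j \<in> {0..<1}) \<and>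
     (\<forall>x\<in>{0..<1}. \<forall>y\<in>{0..<1}. f x y \<ge> 0) \<and>
     (\<exists>W. mono W \<and> (\<forall>N. dispatchers (G N) = {1..W N})) \<and>
     (\<forall>N. servers (G N) = {1..N}) \<and>
     (\<forall>N. \<forall>i\<in>dispatchers (G N). arr_rate (G N) i \<ge> 0) \<and>
     (\<forall>N. \<forall>i\<in>dispatchers (G N). \<forall>j\<in>servers (G N). srv_rate (G N) i j = f (\<phi>1 i) (\<phi>2 j))"

definition is_partition :: "nat \<Rightarrow> (nat \<Rightarrow> real) \<Rightarrow> bool" where
  "is_partition K u \<longleftrightarrow> u 0 = 0 \<and> u K = 1 \<and> (\<forall>k\<in>{1..K}. u (k - 1) < u k)"

definition cell :: "(nat \<Rightarrow> real) \<Rightarrow> nat \<Rightarrow> real set" where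
  "cell u k = {u (k - 1)..<u k}"

definition stepwise ::
  "(real \<Rightarrow> real \<Rightarrow> real) \<Rightarrow> nat \<Rightarrow> (nat \<Rightarrow> real) \<Rightarrow> nat \<Rightarrow> (nat \<Rightarrow> real) \<Rightarrow> (nat \<Rightarrow> nat \<Rightarrow> real) \<Rightarrow> bool"
where
  "stepwise f H w M v \<mu> \<longleftrightarrow> is_partition H w \<and> is_partition M v \<and>
     (\<forall>h\<in>{1..H}. \<forall>m\<in>{1..M}. \<mu> h m \<ge> 0 \<and> (\<forall>x\<in>cell w h. \<forall>y\<in>cell v m. f x y = \<mu> h m))"

definition disp_class :: "(nat \<Rightarrow> real) \<Rightarrow> (nat \<Rightarrow> real) \<Rightarrow> lb_system \<Rightarrow> nat \<Rightarrow> nat set" where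
  "disp_class \<phi>1 w G h = {i \<in> dispatchers G. \<phi>1 i \<in> cell w h}"

definition serv_class :: "(nat \<Rightarrow> real) \<Rightarrow> (nat \<Rightarrow> real) \<Rightarrow> lb_system \<Rightarrow> nat \<Rightarrow> nat set" where
  "serv_class \<phi>2 v G m = {j \<in> servers G. \<phi>2 j \<in> cell v m}"

text \<open>
  In the load condition the quotients are taken in \<^typ>\<open>ereal\<close>, where \<open>0 / 0 = 0\<close> and \<open>a / 0 = \<infinity>\<close> for
  \<open>a > 0\<close>; the condition thus forces \<open>\<mu> h m > 0\<close> whenever \<open>p h m > 0\<close>, and afterwards the
  real-valued quotients below agree with the extended ones.
\<close>

definition subcritical ::
  "(nat \<Rightarrow> real) \<Rightarrow> (nat \<Rightarrow> real) \<Rightarrow> (nat \<Rightarrow> lb_system) \<Rightarrow> nat \<Rightarrow> (nat \<Rightarrow> real) \<Rightarrow> nat \<Rightarrow> (nat \<Rightarrow> real) \<Rightarrow>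
   (nat \<Rightarrow> nat \<Rightarrow> real) \<Rightarrow> (nat \<Rightarrow> real) \<Rightarrow> (nat \<Rightarrow> nat \<Rightarrow> real) \<Rightarrow> bool"
where
  "subcritical \<phi>1 \<phi>2 G H w M v \<mu> \<Lambda> p \<longleftrightarrow>
     (\<forall>h\<in>{1..H}. (\<lambda>N. (\<Sum>i\<in>disp_class \<phi>1 w (G N) h. arr_rate (G N) i) / real N) \<longlonglongrightarrow> \<Lambda> h \<and> \<Lambda> h > 0) \<and>
     (\<forall>m\<in>{1..M}. (\<lambda>N. real (card (serv_class \<phi>2 v (G N) m)) / real N) \<longlonglongrightarrow> v m - v (m - 1)) \<and>
     (\<forall>h\<in>{1..H}. \<forall>m\<in>{1..M}. p h m \<in> {0..1}) \<and>
     (\<forall>h\<in>{1..H}. (\<Sum>m=1..M. p h m) = 1) \<and>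
     (\<forall>m\<in>{1..M}. (\<Sum>h=1..H. ereal (\<Lambda> h * p h m) / ereal (\<mu> h m * (v m - v (m - 1)))) < 1)"

definition slack ::
  "nat \<Rightarrow> (nat \<Rightarrow> real) \<Rightarrow> (nat \<Rightarrow> nat \<Rightarrow> real) \<Rightarrow> (nat \<Rightarrow> real) \<Rightarrow> (nat \<Rightarrow> nat \<Rightarrow> real) \<Rightarrow> nat \<Rightarrow> real"
where
  "slack H v \<mu> \<Lambda> p m = (v m - v (m - 1)) - (\<Sum>h=1..H. \<Lambda> h * p h m / \<mu> h m)"

definition icrd_Poly ::
  "nat \<Rightarrow> nat \<Rightarrow> (nat \<Rightarrow> real) \<Rightarrow> (nat \<Rightarrow> nat \<Rightarrow> real) \<Rightarrow> (nat \<Rightarrow> real) \<Rightarrow> (nat \<Rightarrow> nat \<Rightarrow> real) \<Rightarrow>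
   (nat \<Rightarrow> nat \<Rightarrow> real) set"
where
  "icrd_Poly H M v \<mu> \<Lambda> p = {\<epsilon>.
     (\<forall>h\<in>{1..H}. \<forall>m\<in>{1..M}. \<epsilon> h m \<in> {0..<1}) \<and>
     (\<forall>h\<in>{1..H}. \<exists>c>0. \<forall>m\<in>{1..M}. \<epsilon> h m = c * p h m) \<and>
     (\<forall>m\<in>{1..M}. (\<Sum>h=1..H. \<epsilon> h m) \<le> slack H v \<mu> \<Lambda> p m)}"


section \<open>The ICRD sub-system under JIQ\<close>

text \<open>
  \<open>S h m\<close> is the part of the \<open>m\<close>-th server class reserved for the \<open>h\<close>-th dispatcher class; what
  remains of the server class is unused.
\<close>

definition icrd_division ::
  "(nat \<Rightarrow> real) \<Rightarrow> nat \<Rightarrow> nat \<Rightarrow> (nat \<Rightarrow> real) \<Rightarrow> (nat \<Rightarrow> nat \<Rightarrow> real) \<Rightarrow> (nat \<Rightarrow> real) \<Rightarrow>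
   (nat \<Rightarrow> nat \<Rightarrow> real) \<Rightarrow> (nat \<Rightarrow> nat \<Rightarrow> real) \<Rightarrow> nat \<Rightarrow> lb_system \<Rightarrow> (nat \<Rightarrow> nat \<Rightarrow> nat set) \<Rightarrow> bool"
where
  "icrd_division \<phi>2 H M v \<mu> \<Lambda> p \<epsilon> N G S \<longleftrightarrow>
     (\<forall>m\<in>{1..M}. disjoint_family_on (\<lambda>h. S h m) {1..H} \<and>
        (\<forall>h\<in>{1..H}. S h m \<subseteq> serv_class \<phi>2 v G m \<and>
           card (S h m) = nat \<lfloor>real N * (\<Lambda> h * p h m / \<mu> h m + \<epsilon> h m)\<rfloor>))"

text \<open>
  The pairs \<open>(h, m)\<close> with \<open>i\<close> in the \<open>h\<close>-th dispatcher class and \<open>j \<in> S h m\<close> are at most one, so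
  the double sum is \<open>\<mu> h m\<close> for that pair, and \<open>0\<close> if there is none.
\<close>

definition icrd ::
  "(nat \<Rightarrow> real) \<Rightarrow> nat \<Rightarrow> (nat \<Rightarrow> real) \<Rightarrow> nat \<Rightarrow> (nat \<Rightarrow> nat \<Rightarrow> real) \<Rightarrow> lb_system \<Rightarrow>
   (nat \<Rightarrow> nat \<Rightarrow> nat set) \<Rightarrow> lb_system"
where
  "icrd \<phi>1 H w M \<mu> G S = G\<lparr>srv_rate := (\<lambda>i j. \<Sum>h=1..H. \<Sum>m=1..M.
     if i \<in> disp_class \<phi>1 w G h \<and> j \<in> S h m then \<mu> h m else 0)\<rparr>"

text \<open>The union is over \<open>m\<close> and the unique \<open>h\<close> whose dispatcher class contains \<open>i\<close>.\<close>

definition icrd_pool ::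
  "(nat \<Rightarrow> real) \<Rightarrow> nat \<Rightarrow> (nat \<Rightarrow> real) \<Rightarrow> nat \<Rightarrow> lb_system \<Rightarrow> (nat \<Rightarrow> nat \<Rightarrow> nat set) \<Rightarrow> nat \<Rightarrow> nat set"
where
  "icrd_pool \<phi>1 H w M G S i = (\<Union>h\<in>{h\<in>{1..H}. i \<in> disp_class \<phi>1 w G h}. \<Union>m\<in>{1..M}. S h m)"

definition jiq :: "(nat \<Rightarrow> nat set) \<Rightarrow> policy" where
  "jiq pool i x = (let idle = {j \<in> pool i. \<not> busy x j} in
     pmf_of_set (if idle \<noteq> {} then idle else pool i))"

end

theory Submission
  imports Defs "HOL-Complex_Analysis.Great_Picard"
begin

text \<open>
  For a dispatcher class with pool \<open>P\<close>, let \<open>Q\<close> be the number of waiting tasks in \<open>P\<close>, not counting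
  those in service, and \<open>I\<close> the number of idle servers. If \<open>r < 1\<close> is such that the arrival rate \<open>\<lambda>\<close>
  of the class satisfies \<open>\<lambda> / r + d \<le> C\<close> with \<open>C\<close> the total service rate of the pool and \<open>d\<close> of order
  \<open>N\<close>, then \<open>V = Q - (1 + r + \<dots> + r\<^bsup>I - 1\<^esup>)\<close> is a Lyapunov function. When \<open>I = 0\<close>, arrivals
  raise and departures lower \<open>V\<close> by \<open>1\<close>, so the drift is \<open>\<lambda> - C \<le> - d\<close>. When \<open>I > 0\<close>, arrivals do not increase \<open>Q\<close>, and
  the drift is at most \<open>r\<^bsup>I\<^esup> (\<rho>max I - d) - (1 - r) s\<close> with \<open>s\<close> the total rate of the servers having
  at least two tasks; the first term is uniformly small in \<open>I\<close> once \<open>d\<close> is large. The drift is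
  thus negative as soon as \<open>Q > 0\<close>, which gives a stationary law, and under any stationary law it
  has mean at least \<open>0\<close>, which forces the probability of \<open>I = 0\<close> to be \<open>O(1 / d)\<close>.
\<close>

section \<open>Stationary laws of Markov chains\<close>

text \<open>For an integrable \<open>V\<close>, stationarity makes the mean of \<open>V\<close>
  invariant under a step, so integrating the drift inequality leaves
  \<open>0 <= b - c * prob A\<close>. In general this is done for truncations, followed by a
  monotone limit of events.\<close>

lemma stationary_drift_bound:
  fixes K :: "'a \<Rightarrow> 'a pmf" and V :: "'a \<Rightarrow> real"
  assumes stat: "bind_pmf \<pi> K = \<pi>"
    and lower: "\<And>x. L \<le> V x"
    and fin: "\<And>x. x \<in> set_pmf \<pi> \<Longrightarrow> finite (set_pmf (K x))"
    and drift: "\<And>x. x \<in> set_pmf \<pi> \<Longrightarrow>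
      measure_pmf.expectation (K x) V \<le> V x + b - c * indicator A x"
    and b: "0 \<le> b"
  shows "c * measure_pmf.prob \<pi> A \<le> b"
proof -
  \<comment> \<open>\<open>V\<close> need not be \<open>\<pi>\<close>-integrable, so the drift is integrated for the truncations of \<open>V\<close>.\<close>
  have trunc: "c * measure_pmf.prob \<pi> (A \<inter> {x. V x \<le> real n}) \<le> b" if "n \<ge> nat \<lceil>\<bar>L\<bar>\<rceil>" for n
  proof -
    define T where "T = (\<lambda>x. min (V x) (real n))"
    \<comment> \<open>With \<open>L <= V x\<close> this confines the truncation to the interval from
      \<open>-n\<close> to \<open>n\<close>.\<close>
    have Ln: "\<bar>L\<bar> \<le> real n" using that by linarith
    have bT: "\<bar>T x\<bar> \<le> real n" for x
      using lower[of x] Ln unfolding T_def by auto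
    have int: "integrable (measure_pmf q) T" for q
      by (rule measure_pmf.integrable_const_bound[where B="real n"]) (auto simp: bT)
    have bKT: "\<bar>measure_pmf.expectation (K x) T\<bar> \<le> real n" for x
    proof -
      have "\<bar>measure_pmf.expectation (K x) T\<bar> \<le> measure_pmf.expectation (K x) (\<lambda>y. \<bar>T y\<bar>)"
        by (rule integral_abs_bound)
      also have "\<dots> \<le> real n"
        by (rule measure_pmf.integral_le_const[OF integrable_abs[OF int]]) (auto simp: bT)
      finally show ?thesis .
    qed
    have intK: "integrable (measure_pmf \<pi>) (\<lambda>x. measure_pmf.expectation (K x) T)"
      by (rule measure_pmf.integrable_const_bound[where B="real n"]) (auto simp: bKT)
    have "measure_pmf.expectation \<pi> T = measure_pmf.expectation (bind_pmf \<pi> K) T"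
      using stat by simp
    also have "\<dots> = measure_pmf.expectation \<pi> (\<lambda>x. measure_pmf.expectation (K x) T)"
      unfolding measure_pmf_bind
      by (subst integral_bind[where K="count_space UNIV" and B'=1 and B="real n"])
         (auto simp: bT measure_pmf.emeasure_le_1 measure_subprob
            simp flip: measure_pmf_in_subprob_algebra)
    finally have eq: "measure_pmf.expectation \<pi> T
        = measure_pmf.expectation \<pi> (\<lambda>x. measure_pmf.expectation (K x) T)" .
    \<comment> \<open>Below level \<open>n\<close>, truncating only lowers the expectation after the
      step. Above it, \<open>T\<close> already has its maximum \<open>n\<close> and cannot grow, so
      \<open>0 <= b\<close> suffices.\<close>
    have pt: "c * indicator (A \<inter> {x. V x \<le> real n}) x - b
        \<le> T x - measure_pmf.expectation (K x) T" if x: "x \<in> set_pmf \<pi>" for x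
    proof (cases "V x \<le> real n")
      case True
      have "measure_pmf.expectation (K x) T \<le> measure_pmf.expectation (K x) V"
        by (intro integral_mono int integrable_measure_pmf_finite fin x) (auto simp: T_def)
      then show ?thesis using drift[OF x] True by (auto simp: T_def indicator_def)
    next
      case False
      then show ?thesis using bKT[of x] b by (auto simp: T_def)
    qed
    have "measure_pmf.expectation \<pi> (\<lambda>x. c * indicator (A \<inter> {x. V x \<le> real n}) x - b)
        \<le> measure_pmf.expectation \<pi> (\<lambda>x. T x - measure_pmf.expectation (K x) T)"
      by (intro integral_mono_AE Bochner_Integration.integrable_diff int intK
           integrable_const integrable_mult_right)
         (auto simp: AE_measure_pmf_iff pt intro: pt
            intro!: measure_pmf.integrable_const_bound[where B=1])
    also have "\<dots> = 0" using eq int intK by simp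
    also have "measure_pmf.expectation \<pi> (\<lambda>x. c * indicator (A \<inter> {x. V x \<le> real n}) x - b)
        = c * measure_pmf.prob \<pi> (A \<inter> {x. V x \<le> real n}) - b"
      by (subst Bochner_Integration.integral_diff)
         (auto intro!: integrable_mult_right integrable_real_indicator
           simp: measure_pmf.emeasure_eq_measure simp del: indicator_inter_arith)
    finally show ?thesis by simp
  qed
  have U: "(\<Union>n. A \<inter> {x. V x \<le> real n}) = A"
    using real_arch_simple by auto
  have "(\<lambda>n. measure_pmf.prob \<pi> (A \<inter> {x. V x \<le> real n}))
      \<longlonglongrightarrow> measure_pmf.prob \<pi> (\<Union>n. A \<inter> {x. V x \<le> real n})"
    by (rule measure_pmf.finite_Lim_measure_incseq) (auto simp: incseq_def)
  then have "(\<lambda>n. c * measure_pmf.prob \<pi> (A \<inter> {x. V x \<le> real n}))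
      \<longlonglongrightarrow> c * measure_pmf.prob \<pi> A"
    unfolding U by (intro tendsto_intros)
  then show ?thesis
    by (rule LIMSEQ_le_const2) (use trunc in blast)
qed

section \<open>Iterated kernels, existence of a stationary law, Poisson sampling\<close>

text \<open>This is the iteration inside \<open>transition\<close>, named for an arbitrary kernel so
  that the chain can be studied apart from the Poisson clock.\<close>

definition iterate_law :: "('a \<Rightarrow> 'a pmf) \<Rightarrow> nat \<Rightarrow> 'a pmf \<Rightarrow> 'a pmf" where
  "iterate_law K n D = ((\<lambda>D. bind_pmf D K) ^^ n) D"

lemma iterate_law_0 [simp]: "iterate_law K 0 D = D"
  by (simp add: iterate_law_def)

lemma iterate_law_Suc [simp]: "iterate_law K (Suc n) D = bind_pmf (iterate_law K n D) K"
  by (simp add: iterate_law_def)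

lemma iterate_law_bind:
  "bind_pmf D (\<lambda>x. iterate_law K n (return_pmf x)) = iterate_law K n D"
proof (induction n)
  case 0
  then show ?case by (simp add: bind_return_pmf')
next
  case (Suc n)
  then show ?case by (simp flip: bind_assoc_pmf)
qed

lemma iterate_law_stationary: "bind_pmf D K = D \<Longrightarrow> iterate_law K n D = D"
  by (induction n) auto

text \<open>
  A pointwise limit of the Cesaro means of the law of the chain may lose mass, but the drift keeps
  some mass on \<open>F\<close>, and by Fatou's lemma the limit is sub-invariant, hence invariant.
\<close>

theorem stationary_exists:
  fixes K :: "'a \<Rightarrow> 'a pmf" and V :: "'a \<Rightarrow> real"
  assumes x0: "x0 \<in> S"
    and closed: "\<And>x. x \<in> S \<Longrightarrow> set_pmf (K x) \<subseteq> S"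
    and fin: "\<And>x. x \<in> S \<Longrightarrow> finite (set_pmf (K x))"
    and lower: "\<And>x. L \<le> V x"
    and F: "finite F"
    and drift: "\<And>x. x \<in> S \<Longrightarrow>
      measure_pmf.expectation (K x) V \<le> V x + b - c * indicator (- F) x"
    and bc: "0 \<le> b" "b < c"
  shows "\<exists>\<pi>. set_pmf \<pi> \<subseteq> S \<and> bind_pmf \<pi> K = \<pi>"
proof -
  define R where "R n = iterate_law K n (return_pmf x0)" for n
  have R0: "R 0 = return_pmf x0" and RS: "R (Suc n) = bind_pmf (R n) K" for n
    by (auto simp: R_def)
  \<comment> \<open>Finite supports make \<open>V\<close> integrable under each \<open>R n\<close>,
    although \<open>V\<close> may be unbounded above.\<close>
  have inv: "set_pmf (R n) \<subseteq> S \<and> finite (set_pmf (R n))" for n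
  proof (induction n)
    case 0
    then show ?case using x0 by (simp add: R0)
  next
    case (Suc n)
    then show ?case using closed fin unfolding RS by (auto simp: set_bind_pmf)
  qed
  have stepR: "measure_pmf.expectation (R (Suc n)) V
      \<le> measure_pmf.expectation (R n) V + b - c * measure_pmf.prob (R n) (- F)" for n
  proof -
    have fR: "finite (set_pmf (R n))" and sR: "set_pmf (R n) \<subseteq> S" using inv by auto
    have "measure_pmf.expectation (R (Suc n)) V
        = measure_pmf.expectation (R n) (\<lambda>x. measure_pmf.expectation (K x) V)"
      unfolding RS
      by (subst pmf_expectation_bind[OF fR])
         (use sR fin in \<open>auto simp: integral_measure_pmf[OF fR]\<close>)
    also have "\<dots> \<le> measure_pmf.expectation (R n) (\<lambda>x. V x + b - c * indicator (- F) x)"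
      by (intro integral_mono_AE integrable_measure_pmf_finite fR)
         (use sR drift in \<open>auto simp: AE_measure_pmf_iff\<close>)
    also have "\<dots> = measure_pmf.expectation (R n) V + b - c * measure_pmf.prob (R n) (- F)"
      by (simp add: integrable_measure_pmf_finite[OF fR])
    finally show ?thesis .
  qed
  \<comment> \<open>Summing the drift over time bounds the expected number of visits outside
    \<open>F\<close>.\<close>
  have tele: "c * (\<Sum>k<n. measure_pmf.prob (R k) (- F)) + measure_pmf.expectation (R n) V
      \<le> V x0 + real n * b" for n
  proof (induction n)
    case 0
    then show ?case by (simp add: R0)
  next
    case (Suc n)
    then show ?case using stepR[of n] by (simp add: algebra_simps)
  qed
  have EL: "L \<le> measure_pmf.expectation (R n) V" for n
    by (rule measure_pmf.integral_ge_const)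
       (use inv lower in \<open>auto intro: integrable_measure_pmf_finite\<close>)
  \<comment> \<open>The Cesaro mean, written as the law of the chain at a uniformly random
    time.\<close>
  define A where "A n = bind_pmf (pmf_of_set {..n}) R" for n
  have pA: "pmf (A n) y = (\<Sum>k<Suc n. pmf (R k) y) / real (Suc n)" for n y
    unfolding A_def by (subst pmf_bind_pmf_of_set) (auto simp: lessThan_Suc_atMost)
  have probA: "measure_pmf.prob (A n) F = (\<Sum>k<Suc n. measure_pmf.prob (R k) F) / real (Suc n)" for n
    using F by (simp add: measure_measure_pmf_finite pA sum_divide_distrib sum.swap[of _ F])
  \<comment> \<open>In the long run at most the fraction \<open>b / c\<close> of the time is spent
    outside \<open>F\<close>, so \<open>A n\<close> keeps mass \<delta> on \<open>F\<close> up to an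
    error of order \<open>1 / n\<close>.\<close>
  define \<delta> where "\<delta> = 1 - b / c"
  have \<delta>: "\<delta> > 0" using bc by (simp add: \<delta>_def)
  have AF: "measure_pmf.prob (A n) F \<ge> \<delta> - (V x0 - L) / (c * real (Suc n))" for n
  proof -
    have c0: "c > 0" using bc by linarith
    have "(\<Sum>k<Suc n. measure_pmf.prob (R k) (- F))
        = real (Suc n) - (\<Sum>k<Suc n. measure_pmf.prob (R k) F)"
      using measure_pmf.prob_compl[of F]
      by (simp add: Compl_eq_Diff_UNIV sum_subtractf del: sum.lessThan_Suc)
    then have "c * (real (Suc n) - (\<Sum>k<Suc n. measure_pmf.prob (R k) F)) \<le> V x0 - L + real (Suc n) * b"
      using tele[of "Suc n"] EL[of "Suc n"] by simp
    then have "c * (real (Suc n) - real (Suc n) * measure_pmf.prob (A n) F) \<le> V x0 - L + real (Suc n) * b"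
      by (simp add: probA del: sum.lessThan_Suc of_nat_Suc)
    then have "1 - measure_pmf.prob (A n) F \<le> (V x0 - L + real (Suc n) * b) / (c * real (Suc n))"
      using c0 by (subst pos_le_divide_eq) (auto simp: algebra_simps simp del: of_nat_Suc)
    also have "\<dots> = (V x0 - L) / (c * real (Suc n)) + b / c"
      using c0 by (simp add: add_divide_distrib del: of_nat_Suc)
    finally show ?thesis unfolding \<delta>_def by linarith
  qed
  \<comment> \<open>Only countably many states are ever reached, so one subsequence converges at all
    of them; at any other state every \<open>A n\<close> has mass 0.\<close>
  define T where "T = (\<Union>n. set_pmf (R n))"
  have cT: "countable T" unfolding T_def using countable_set_pmf by auto
  have TS: "T \<subseteq> S" using inv by (auto simp: T_def)
  obtain k where k: "strict_mono (k::nat\<Rightarrow>nat)"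
    and ex: "\<And>x. x \<in> T \<Longrightarrow> \<exists>l. (\<lambda>n. pmf (A (k n)) x) \<longlonglongrightarrow> l"
    by (rule function_convergent_subsequence[OF cT, of "\<lambda>n. pmf (A n)" 1]) (auto simp: pmf_le_1)
  have A0: "pmf (A n) x = 0" if "x \<notin> T" for n x
    using that by (auto simp: pA T_def set_pmf_iff)
  have "\<exists>l. \<forall>x. (\<lambda>n. pmf (A (k n)) x) \<longlonglongrightarrow> l x"
  proof (rule choice, rule allI)
    show "\<exists>l. (\<lambda>n. pmf (A (k n)) x) \<longlonglongrightarrow> l" for x
      using ex[of x] A0[of x] by (cases "x \<in> T") (auto intro: exI[of _ 0])
  qed
  then obtain l where l: "\<And>x. (\<lambda>n. pmf (A (k n)) x) \<longlonglongrightarrow> l x" by blast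
  have l0: "l x \<ge> 0" for x using l by (rule LIMSEQ_le_const) auto
  have lT: "l x = 0" if "x \<notin> T" for x
    using l[of x] A0[OF that] by (simp add: LIMSEQ_const_iff)
  have kinf: "filterlim k at_top sequentially" using k by (rule filterlim_subseq)
  have lF: "(\<Sum>x\<in>F. l x) \<ge> \<delta>"
  proof (rule LIMSEQ_le)
    show "(\<lambda>n. measure_pmf.prob (A (k n)) F) \<longlonglongrightarrow> (\<Sum>x\<in>F. l x)"
      unfolding measure_measure_pmf_finite[OF F] by (intro tendsto_intros l)
    have "(\<lambda>n. \<delta> - (V x0 - L) / (c * real (Suc n))) \<longlonglongrightarrow> \<delta>"
      using bc by real_asymp
    then show "(\<lambda>n. \<delta> - (V x0 - L) / (c * real (Suc (k n)))) \<longlonglongrightarrow> \<delta>"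
      by (rule filterlim_compose) (rule kinf)
    show "\<exists>N. \<forall>n\<ge>N. \<delta> - (V x0 - L) / (c * real (Suc (k n))) \<le> measure_pmf.prob (A (k n)) F"
      using AF by blast
  qed
  have lim: "liminf (\<lambda>n. ennreal (pmf (A (k n)) x)) = ennreal (l x)" for x
    using l[of x] by (intro lim_imp_Liminf) auto
  \<comment> \<open>Fatou's lemma gives \<open>Z <= 1\<close> and the mass kept on the finite set
    \<open>F\<close> gives \<open>Z > 0\<close>, so the limit can be normalized.\<close>
  define Z where "Z = (\<integral>\<^sup>+x. ennreal (l x) \<partial>count_space UNIV)"
  have Z1: "Z \<le> 1"
  proof -
    have "Z \<le> liminf (\<lambda>n. \<integral>\<^sup>+x. ennreal (pmf (A (k n)) x) \<partial>count_space UNIV)"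
      unfolding Z_def lim[symmetric] by (rule nn_integral_liminf) auto
    also have "\<dots> = 1" by (simp add: nn_integral_pmf measure_pmf.emeasure_space_1[simplified] Liminf_const)
    finally show ?thesis .
  qed
  have Zpos: "Z > 0"
  proof -
    obtain x where "x \<in> F" "l x > 0"
      using lF \<delta> l0 by (metis less_le_not_le order_trans sum_nonpos le_less_linear)
    have "ennreal (l x) = (\<integral>\<^sup>+y. ennreal (l x) * indicator {x} y \<partial>count_space UNIV)"
      by (simp add: nn_integral_cmult_indicator)
    also have "\<dots> \<le> Z" unfolding Z_def by (intro nn_integral_mono) (auto simp: indicator_def)
    finally show ?thesis using \<open>l x > 0\<close> by (metis ennreal_less_zero_iff order_less_le_trans)
  qed
  define z where "z = enn2real Z"
  have z: "z > 0" "Z = ennreal z"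
    using Z1 Zpos by (auto simp: z_def enn2real_positive_iff top.not_eq_extremum
       intro!: ennreal_enn2real[symmetric] order_le_less_trans[OF Z1])
  have tot: "(\<integral>\<^sup>+x. ennreal (l x / z) \<partial>count_space UNIV) = 1"
  proof -
    have "(\<integral>\<^sup>+x. ennreal (l x / z) \<partial>count_space UNIV) = (\<integral>\<^sup>+x. ennreal (l x) / ennreal z \<partial>count_space UNIV)"
      using z l0 by (simp add: divide_ennreal)
    also have "\<dots> = Z / ennreal z" unfolding Z_def by (rule nn_integral_divide) auto
    also have "\<dots> = 1" using z by (simp add: ennreal_divide_self)
    finally show ?thesis .
  qed
  define \<pi> where "\<pi> = embed_pmf (\<lambda>x. l x / z)"
  have p\<pi>: "pmf \<pi> x = l x / z" for x
    unfolding \<pi>_def by (rule pmf_embed_pmf) (use l0 z tot in auto)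
  have sub: "set_pmf \<pi> \<subseteq> S"
  proof
    fix x assume "x \<in> set_pmf \<pi>"
    then have "x \<in> T" using lT[of x] by (auto simp: set_pmf_iff p\<pi>)
    then show "x \<in> S" using TS by blast
  qed
  have le: "pmf (bind_pmf \<pi> K) y \<le> pmf \<pi> y" for y
  proof -
    \<comment> \<open>A step moves the time window by one: the mean loses \<open>R 0\<close> and
      gains \<open>R (Suc n)\<close>, a change of at most \<open>1 / Suc n\<close>.\<close>
    have shift: "pmf (bind_pmf (A n) K) y \<le> pmf (A n) y + 1 / real (Suc n)" for n
    proof -
      have "bind_pmf (A n) K = bind_pmf (pmf_of_set {..n}) (\<lambda>k. R (Suc k))"
        unfolding A_def RS bind_assoc_pmf ..
      then have "pmf (bind_pmf (A n) K) y = (\<Sum>k<Suc n. pmf (R (Suc k)) y) / real (Suc n)"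
        by (subst \<open>bind_pmf (A n) K = _\<close>, subst pmf_bind_pmf_of_set) (auto simp: lessThan_Suc_atMost)
      also have "(\<Sum>k<Suc n. pmf (R (Suc k)) y) = (\<Sum>k<Suc n. pmf (R k) y) + pmf (R (Suc n)) y - pmf (R 0) y"
        by (induction n) auto
      also have "\<dots> \<le> (\<Sum>k<Suc n. pmf (R k) y) + 1"
        using pmf_le_1[of "R (Suc n)" y] pmf_nonneg[of "R 0" y] by linarith
      finally show ?thesis
        unfolding pA by (simp add: add_divide_distrib divide_right_mono del: sum.lessThan_Suc)
    qed
    have "(\<integral>\<^sup>+x. ennreal (l x) * ennreal (pmf (K x) y) \<partial>count_space UNIV)
        = (\<integral>\<^sup>+x. liminf (\<lambda>n. ennreal (pmf (A (k n)) x) * ennreal (pmf (K x) y)) \<partial>count_space UNIV)"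
    proof (rule nn_integral_cong)
      fix x
      have "(\<lambda>n. ennreal (pmf (A (k n)) x * pmf (K x) y)) \<longlonglongrightarrow> ennreal (l x * pmf (K x) y)"
        by (intro tendsto_intros l)
      then have "liminf (\<lambda>n. ennreal (pmf (A (k n)) x * pmf (K x) y)) = ennreal (l x * pmf (K x) y)"
        by (intro lim_imp_Liminf) auto
      then show "ennreal (l x) * ennreal (pmf (K x) y)
          = liminf (\<lambda>n. ennreal (pmf (A (k n)) x) * ennreal (pmf (K x) y))"
        using l0 by (simp add: ennreal_mult)
    qed
    also have "\<dots> \<le> liminf (\<lambda>n. \<integral>\<^sup>+x. ennreal (pmf (A (k n)) x) * ennreal (pmf (K x) y) \<partial>count_space UNIV)"
      by (rule nn_integral_liminf) auto
    also have "\<dots> = liminf (\<lambda>n. ennreal (pmf (bind_pmf (A (k n)) K) y))"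
      by (simp add: ennreal_pmf_bind nn_integral_measure_pmf)
    also have "\<dots> \<le> liminf (\<lambda>n. ennreal (pmf (A (k n)) y + 1 / real (Suc (k n))))"
      by (intro Liminf_mono always_eventually allI ennreal_leI shift)
    also have "\<dots> = ennreal (l y + 0)"
    proof (intro lim_imp_Liminf tendsto_ennrealI tendsto_add l)
      have "(\<lambda>n. 1 / real (Suc n)) \<longlonglongrightarrow> 0" by real_asymp
      then show "(\<lambda>n. 1 / real (Suc (k n))) \<longlonglongrightarrow> 0"
        by (rule filterlim_compose) (rule kinf)
    qed auto
    finally have main: "(\<integral>\<^sup>+x. ennreal (l x) * ennreal (pmf (K x) y) \<partial>count_space UNIV) \<le> ennreal (l y)"
      by simp
    have "ennreal (pmf (bind_pmf \<pi> K) y)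
        = (\<integral>\<^sup>+x. (ennreal (l x) * ennreal (pmf (K x) y)) / ennreal z \<partial>count_space UNIV)"
      using z l0 by (auto simp: ennreal_pmf_bind nn_integral_measure_pmf p\<pi>
         divide_ennreal ennreal_mult[symmetric] intro!: nn_integral_cong)
    also have "\<dots> = (\<integral>\<^sup>+x. ennreal (l x) * ennreal (pmf (K x) y) \<partial>count_space UNIV) / ennreal z"
      by (rule nn_integral_divide) auto
    also have "\<dots> \<le> ennreal (l y) / ennreal z"
      by (rule divide_right_mono_ennreal) (rule main)
    also have "\<dots> = ennreal (pmf \<pi> y)"
      using z l0 by (simp add: p\<pi> divide_ennreal)
    finally show ?thesis by simp
  qed
  \<comment> \<open>Both sides have total mass 1, so domination at every point is equality.\<close>
  have "bind_pmf \<pi> K = \<pi>"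
    using pmf_neq_exists_less[of \<pi> "bind_pmf \<pi> K"] le by (metis not_less)
  with sub show ?thesis by blast
qed

text \<open>For small \<open>s\<close> there is no ring with probability about \<open>1 - s\<close>
  and one ring with probability about \<open>s\<close>; the first-order term in \<open>s\<close> of
  the invariance isolates a single step of \<open>K\<close>.\<close>

lemma poisson_mixture_stationary:
  fixes K :: "'a \<Rightarrow> 'a pmf"
  assumes mix: "\<And>s. s > 0 \<Longrightarrow> bind_pmf (poisson_pmf s) (\<lambda>n. iterate_law K n \<pi>) = \<pi>"
  shows "bind_pmf \<pi> K = \<pi>"
proof (rule pmf_eqI)
  fix y
  define a where "a n = pmf (iterate_law K n \<pi>) y" for n
  have a01: "0 \<le> a n" "a n \<le> 1" for n by (auto simp: a_def pmf_le_1)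
  \<comment> \<open>comparing the first two coefficients of \<open>exp s * a 0 = (\<Sum>n. s ^ n / fact n * a n)\<close> as \<open>s \<rightarrow> 0\<close>\<close>
  have bound: "\<bar>a 1 - a 0\<bar> \<le> (exp s - 1 - s) / s" if s: "s > 0" for s :: real
  proof -
    let ?f = "\<lambda>n. s ^ n / fact n * a n"
    have sume: "(\<lambda>n. s ^ n / fact n) sums exp s"
      using exp_converges[of s] by (simp add: divide_inverse mult.commute scaleR_conv_of_real)
    have summ: "summable ?f"
      by (rule summable_comparison_test[OF _ sums_summable[OF sume]])
         (use a01 s in \<open>auto simp: abs_mult intro!: exI[of _ 0] divide_right_mono mult_left_le\<close>)
    have "pmf \<pi> y = (\<integral>n. a n \<partial>measure_pmf (poisson_pmf s))"
      using mix[OF s] unfolding a_def by (metis pmf_bind)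
    also have "\<dots> = (\<integral>n. s ^ n / fact n * exp (- s) * a n \<partial>count_space UNIV)"
      unfolding measure_pmf_eq_density using s
      by (subst integral_density) auto
    also have "\<dots> = (\<Sum>n. s ^ n / fact n * exp (- s) * a n)"
    proof (rule integral_count_space_nat)
      have "summable (\<lambda>n. exp (- s) * ?f n)" using summ by (rule summable_mult)
      then show "integrable (count_space UNIV) (\<lambda>n. s ^ n / fact n * exp (- s) * a n)"
        unfolding integrable_count_space_nat_iff
        using s a01 by (simp add: abs_mult mult_ac)
    qed
    also have "\<dots> = exp (- s) * (\<Sum>n. ?f n)"
      using suminf_mult[OF summ, of "exp (-s)"] by (simp add: mult_ac)
    finally have e1: "exp s * a 0 = (\<Sum>n. ?f n)"
      by (simp add: a_def exp_minus field_simps)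
    \<comment> \<open>The terms of order at least two; since each \<open>a n\<close> lies in [0, 1],
      they total between 0 and \<open>exp s - 1 - s\<close>.\<close>
    define t where "t = (\<Sum>n. ?f (n + 2))"
    have e2: "(\<Sum>n. ?f n) = a 0 + s * a 1 + t"
      unfolding t_def using suminf_split_initial_segment[OF summ, of 2] by (simp add: numeral_2_eq_2)
    have sume2: "(\<lambda>n. s ^ (n+2) / fact (n+2)) sums (exp s - 1 - s)"
      using sums_split_initial_segment[OF sume, of 2] by (simp add: numeral_2_eq_2 algebra_simps)
    have t0: "0 \<le> t" unfolding t_def using summ s a01
      by (intro suminf_nonneg summable_ignore_initial_segment) (auto simp del: fact_Suc)
    have "t \<le> (\<Sum>n. s ^ (n+2) / fact (n+2))"
      unfolding t_def
      using summable_ignore_initial_segment[OF summ, of 2] sums_summable[OF sume2] s a01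
      by (intro suminf_le) (auto intro!: divide_right_mono mult_left_le simp del: fact_Suc power_Suc)
    then have t1: "t \<le> exp s - 1 - s" using sume2 by (simp add: sums_iff)
    \<comment> \<open>A difference of two numbers between 0 and \<open>exp s - 1 - s\<close> is
      bounded by \<open>exp s - 1 - s\<close> in absolute value.\<close>
    have "s * (a 1 - a 0) = (exp s - 1 - s) * a 0 - t" using e1 e2 by (simp add: algebra_simps)
    moreover have "(exp s - 1 - s) * a 0 \<le> exp s - 1 - s" "0 \<le> (exp s - 1 - s) * a 0"
      using a01[of 0] t0 t1 by (auto intro: mult_left_le)
    ultimately have "\<bar>s * (a 1 - a 0)\<bar> \<le> exp s - 1 - s" using t0 t1 by linarith
    then have "s * \<bar>a 1 - a 0\<bar> \<le> exp s - 1 - s"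
      using s by (simp only: abs_mult abs_of_pos)
    then show ?thesis
      using s by (subst pos_le_divide_eq) (auto simp: mult.commute)
  qed
  have "((\<lambda>s::real. (exp s - 1 - s) / s) \<longlongrightarrow> 0) (at_right 0)"
    by real_asymp
  then have "\<bar>a 1 - a 0\<bar> \<le> 0"
    by (rule tendsto_lowerbound)
       (auto intro: eventually_mono[OF eventually_at_right_less] bound simp del: One_nat_def)
  then show "pmf (bind_pmf \<pi> K) y = pmf \<pi> y" by (simp add: a_def)
qed

section \<open>The generator of a load balancing system\<close>

text \<open>The infinitesimal generator of the Markov process, with arrivals and services kept
  apart; \<open>step_expectation\<close> ties it to the drift of \<open>step\<close>.\<close>

definition generator :: "lb_system \<Rightarrow> policy \<Rightarrow> (state \<Rightarrow> real) \<Rightarrow> state \<Rightarrow> real" where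
  "generator G A V x =
     (\<Sum>i\<in>dispatchers G. arr_rate G i *
        (measure_pmf.expectation (A i x) (\<lambda>j. V (x(j := x j @ [i]))) - V x)) +
     (\<Sum>i\<in>dispatchers G. \<Sum>j\<in>servers G. srv_rate G i j *
        (if x j \<noteq> [] \<and> hd (x j) = i then V (x(j := tl (x j))) - V x else 0))"

text \<open>Finite supports let the expectation pass through the sum. This allows the Lyapunov
  functions of the dispatcher classes to be added.\<close>

lemma generator_sum:
  assumes "\<And>i. i \<in> dispatchers G \<Longrightarrow> finite (set_pmf (A i x))"
  shows "generator G A (\<lambda>x. \<Sum>h\<in>J. V h x) x = (\<Sum>h\<in>J. generator G A (V h) x)"
proof -
  have "measure_pmf.expectation (A i x) (\<lambda>j. \<Sum>h\<in>J. V h (x(j := x j @ [i])))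
      = (\<Sum>h\<in>J. measure_pmf.expectation (A i x) (\<lambda>j. V h (x(j := x j @ [i]))))"
    if "i \<in> dispatchers G" for i
    by (rule Bochner_Integration.integral_sum) (intro integrable_measure_pmf_finite assms that)
  then have 1: "(\<Sum>i\<in>dispatchers G. arr_rate G i *
        (measure_pmf.expectation (A i x) (\<lambda>j. \<Sum>h\<in>J. V h (x(j := x j @ [i]))) - (\<Sum>h\<in>J. V h x)))
      = (\<Sum>h\<in>J. \<Sum>i\<in>dispatchers G. arr_rate G i *
        (measure_pmf.expectation (A i x) (\<lambda>j. V h (x(j := x j @ [i]))) - V h x))"
    by (subst sum.swap) (intro sum.cong refl, simp add: sum_subtractf sum_distrib_left right_diff_distrib)
  have "(if P then (\<Sum>h\<in>J. a h) - (\<Sum>h\<in>J. b h) else 0) = (\<Sum>h\<in>J. if P then a h - b h else (0::real))"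
    for P and a b :: "_ \<Rightarrow> real"
    by (simp add: sum_subtractf)
  then have 2: "(\<Sum>i\<in>dispatchers G. \<Sum>j\<in>servers G. srv_rate G i j *
        (if x j \<noteq> [] \<and> hd (x j) = i then (\<Sum>h\<in>J. V h (x(j := tl (x j)))) - (\<Sum>h\<in>J. V h x) else 0))
      = (\<Sum>h\<in>J. \<Sum>i\<in>dispatchers G. \<Sum>j\<in>servers G. srv_rate G i j *
        (if x j \<noteq> [] \<and> hd (x j) = i then V h (x(j := tl (x j))) - V h x else 0))"
    by (subst sum.swap, intro sum.cong refl, subst sum.swap, intro sum.cong refl)
       (simp add: sum_distrib_left)
  show ?thesis
    unfolding generator_def sum.distrib 1 2 ..
qed

section \<open>The process seen through its chain of clock rings\<close>

text \<open>\<open>admissible\<close> serves twice: with finitely many servers it makes every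
  assignment law finitely supported, and it keeps the chain inside \<open>states G\<close>.\<close>

locale load_balancing =
  fixes G :: lb_system and A :: policy
  assumes finD: "finite (dispatchers G)" and finS: "finite (servers G)"
    and arr_nn: "i \<in> dispatchers G \<Longrightarrow> 0 \<le> arr_rate G i"
    and srv_nn: "i \<in> dispatchers G \<Longrightarrow> j \<in> servers G \<Longrightarrow> 0 \<le> srv_rate G i j"
    and arr_pos: "0 < (\<Sum>i\<in>dispatchers G. arr_rate G i)"
    and admissible: "i \<in> dispatchers G \<Longrightarrow> j \<in> set_pmf (A i x) \<Longrightarrow> j \<in> servers G \<and> 0 < srv_rate G i j"
begin

lemma fin_policy: "i \<in> dispatchers G \<Longrightarrow> finite (set_pmf (A i x))"
  using admissible finS by (meson finite_subset subsetI)

lemma finE: "finite (events G)"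
  using finD finS by (simp add: events_def)

lemma sum_events:
  "(\<Sum>e\<in>events G. g e)
    = (\<Sum>i\<in>dispatchers G. g (Arrival i)) + (\<Sum>i\<in>dispatchers G. \<Sum>j\<in>servers G. g (Service i j))"
  for g :: "event \<Rightarrow> real"
proof -
  have "(\<Sum>e\<in>events G. g e) = (\<Sum>e\<in>Arrival ` dispatchers G. g e)
      + (\<Sum>e\<in>(\<lambda>(i, j). Service i j) ` (dispatchers G \<times> servers G). g e)"
    unfolding events_def using finD finS by (intro sum.union_disjoint) auto
  also have "(\<Sum>e\<in>Arrival ` dispatchers G. g e) = (\<Sum>i\<in>dispatchers G. g (Arrival i))"
    by (subst sum.reindex) (auto simp: inj_on_def)
  also have "(\<Sum>e\<in>(\<lambda>(i, j). Service i j) ` (dispatchers G \<times> servers G). g e)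
      = (\<Sum>(i, j)\<in>dispatchers G \<times> servers G. g (Service i j))"
    by (subst sum.reindex) (auto simp: inj_on_def case_prod_unfold intro!: sum.cong)
  also have "\<dots> = (\<Sum>i\<in>dispatchers G. \<Sum>j\<in>servers G. g (Service i j))"
    using sum.cartesian_product by metis
  finally show ?thesis .
qed

lemma event_rate_nn: "e \<in> events G \<Longrightarrow> 0 \<le> event_rate G e"
  using arr_nn srv_nn by (auto simp: events_def)

lemma total_pos: "0 < total_rate G"
  unfolding total_rate_def sum_events using arr_pos srv_nn
  by (auto intro!: add_pos_nonneg sum_nonneg)

lemma pmf_event: "pmf (event_pmf G) e = (if e \<in> events G then event_rate G e / total_rate G else 0)"
  unfolding event_pmf_def
proof (rule pmf_embed_pmf)
  show "0 \<le> (if e \<in> events G then event_rate G e / total_rate G else 0)" for e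
    using event_rate_nn total_pos by auto
  have "(\<integral>\<^sup>+e. ennreal (if e \<in> events G then event_rate G e / total_rate G else 0) \<partial>count_space UNIV)
      = (\<Sum>e\<in>events G. ennreal (event_rate G e / total_rate G))"
    by (subst nn_integral_count_space'[OF finE]) auto
  also have "\<dots> = ennreal (\<Sum>e\<in>events G. event_rate G e / total_rate G)"
    using event_rate_nn total_pos by (intro sum_ennreal) auto
  also have "(\<Sum>e\<in>events G. event_rate G e / total_rate G) = 1"
    using total_pos by (simp add: total_rate_def flip: sum_divide_distrib)
  finally show "(\<integral>\<^sup>+e. ennreal (if e \<in> events G then event_rate G e / total_rate G else 0)
      \<partial>count_space UNIV) = 1"
    by simp
qed

lemma set_event_pmf: "set_pmf (event_pmf G) \<subseteq> events G"
  by (auto simp: set_pmf_iff pmf_event split: if_splits)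

lemma fin_apply: "e \<in> events G \<Longrightarrow> finite (set_pmf (apply_event A e x))"
  using fin_policy by (auto simp: events_def)

lemma fin_step: "finite (set_pmf (step G A x))"
  unfolding step_def set_bind_pmf
  using finite_subset[OF set_event_pmf finE] fin_apply set_event_pmf by auto

text \<open>Uniformization: a ring is the event \<open>e\<close> with probability its rate over
  \<open>total_rate G\<close>, and rings without effect add nothing to the drift.\<close>

lemma step_expectation:
  "measure_pmf.expectation (step G A x) V = V x + generator G A V x / total_rate G"
proof -
  let ?E = "\<lambda>e. measure_pmf.expectation (apply_event A e x) V"
  have "measure_pmf.expectation (step G A x) V = (\<Sum>e\<in>events G. event_rate G e / total_rate G * ?E e)"
    unfolding step_def
    by (subst pmf_expectation_bind[OF finE fin_apply set_event_pmf]) (auto simp: pmf_event)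
  also have "\<dots> = (\<Sum>e\<in>events G. event_rate G e / total_rate G * (?E e - V x))
      + (\<Sum>e\<in>events G. event_rate G e / total_rate G) * V x"
    by (simp add: sum_distrib_right right_diff_distrib flip: sum.distrib)
  also have "(\<Sum>e\<in>events G. event_rate G e / total_rate G) = 1"
    using total_pos by (simp add: total_rate_def flip: sum_divide_distrib)
  also have "(\<Sum>e\<in>events G. event_rate G e / total_rate G * (?E e - V x))
      = (\<Sum>e\<in>events G. event_rate G e * (?E e - V x)) / total_rate G"
    by (simp add: sum_divide_distrib)
  also have "(\<Sum>e\<in>events G. event_rate G e * (?E e - V x)) = generator G A V x"
    unfolding sum_events generator_def by (auto intro!: arg_cong2[where f="(+)"] sum.cong)
  finally show ?thesis by simp
qed

lemma states_step: "x \<in> states G \<Longrightarrow> set_pmf (step G A x) \<subseteq> states G"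
proof
  fix y assume x: "x \<in> states G" and "y \<in> set_pmf (step G A x)"
  then obtain e where e: "e \<in> events G" and y: "y \<in> set_pmf (apply_event A e x)"
    using set_event_pmf unfolding step_def by (auto simp: set_bind_pmf)
  show "y \<in> states G"
  proof (cases e)
    case (Arrival i)
    then have i: "i \<in> dispatchers G" using e by (auto simp: events_def)
    obtain j where j: "j \<in> set_pmf (A i x)" and "y = x(j := x j @ [i])"
      using y Arrival by auto
    then show ?thesis using x i admissible[OF i j] by (auto simp: states_def)
  next
    case (Service i j)
    then show ?thesis using x y e
      by (auto simp: states_def events_def split: if_splits dest: list.set_sel(2))
  qed
qed

text \<open>The number of rings does not depend on the state, so the law at time \<open>t\<close> is
  a Poisson mixture of iterates of \<open>step\<close>. Invariance under \<open>step\<close> then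
  passes to every \<open>t\<close>, and \<open>poisson_mixture_stationary\<close> gives the
  converse.\<close>

lemma steady_state_iff:
  "steady_state G A \<pi> \<longleftrightarrow> set_pmf \<pi> \<subseteq> states G \<and> bind_pmf \<pi> (step G A) = \<pi>"
proof -
  have eq: "bind_pmf \<pi> (transition G A t)
      = bind_pmf (poisson_pmf (total_rate G * t)) (\<lambda>n. iterate_law (step G A) n \<pi>)" for t
    unfolding transition_def iterate_law_def[symmetric]
    by (subst bind_commute_pmf) (simp add: iterate_law_bind)
  have "bind_pmf \<pi> (step G A) = \<pi>" if st: "\<forall>t>0. bind_pmf \<pi> (transition G A t) = \<pi>"
  proof (rule poisson_mixture_stationary)
    fix s :: real assume "s > 0"
    then show "bind_pmf (poisson_pmf s) (\<lambda>n. iterate_law (step G A) n \<pi>) = \<pi>"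
      using st[rule_format, of "s / total_rate G"] total_pos eq[of "s / total_rate G"] by simp
  qed
  moreover have "bind_pmf \<pi> (transition G A t) = \<pi>" if "bind_pmf \<pi> (step G A) = \<pi>" for t
    unfolding eq iterate_law_stationary[OF that] by (simp add: bind_pmf_const)
  ultimately show ?thesis unfolding steady_state_def by blast
qed

section \<open>Drift criteria for steady states, and the queueing probability\<close>

lemma steady_state_prob_bound:
  assumes st: "steady_state G A \<pi>"
    and lower: "\<And>x. L \<le> V x"
    and drift: "\<And>x. x \<in> states G \<Longrightarrow> generator G A V x \<le> b - c * indicator B x"
    and b: "0 \<le> b"
  shows "c * measure_pmf.prob \<pi> B \<le> b"
proof -
  have st': "set_pmf \<pi> \<subseteq> states G" "bind_pmf \<pi> (step G A) = \<pi>" using st steady_state_iff by auto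
  have "c / total_rate G * measure_pmf.prob \<pi> B \<le> b / total_rate G"
  proof (rule stationary_drift_bound[OF st'(2) lower fin_step])
    fix x assume "x \<in> set_pmf \<pi>"
    then have "generator G A V x / total_rate G \<le> (b - c * indicator B x) / total_rate G"
      using drift st'(1) total_pos by (intro divide_right_mono) auto
    then show "measure_pmf.expectation (step G A x) V
        \<le> V x + b / total_rate G - c / total_rate G * indicator B x"
      by (simp add: step_expectation diff_divide_distrib)
  qed (use b total_pos in auto)
  then show ?thesis using total_pos by (simp add: field_simps)
qed

lemma steady_state_exists:
  assumes lower: "\<And>x. L \<le> V x"
    and drift: "\<And>x. x \<in> states G \<Longrightarrow> generator G A V x \<le> b - c * indicator (- F) x"
    and F: "finite F" and bc: "0 \<le> b" "b < c"
  shows "\<exists>\<pi>. steady_state G A \<pi>"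
proof -
  have "\<exists>\<pi>. set_pmf \<pi> \<subseteq> states G \<and> bind_pmf \<pi> (step G A) = \<pi>"
  proof (rule stationary_exists[where V=V and L=L and F=F and b="b / total_rate G" and c="c / total_rate G"])
    show "(\<lambda>_. []) \<in> states G" by (simp add: states_def)
    fix x assume "x \<in> states G"
    then have "generator G A V x / total_rate G \<le> (b - c * indicator (- F) x) / total_rate G"
      using drift total_pos by (intro divide_right_mono) auto
    then show "measure_pmf.expectation (step G A x) V
        \<le> V x + b / total_rate G - c / total_rate G * indicator (- F) x"
      by (simp add: step_expectation diff_divide_distrib)
  qed (use fin_step states_step lower F bc total_pos in \<open>auto simp: divide_strict_right_mono\<close>)
  then show ?thesis using steady_state_iff by blast
qed

lemma pmf_new_task:
  "pmf (new_task_pmf G) i =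
     (if i \<in> dispatchers G then arr_rate G i / (\<Sum>i\<in>dispatchers G. arr_rate G i) else 0)"
  unfolding new_task_pmf_def
proof (rule pmf_embed_pmf)
  let ?f = "\<lambda>i. if i \<in> dispatchers G then arr_rate G i / (\<Sum>i\<in>dispatchers G. arr_rate G i) else 0"
  show "0 \<le> ?f i" for i using arr_nn arr_pos by auto
  have "(\<integral>\<^sup>+i. ennreal (?f i) \<partial>count_space UNIV)
      = (\<Sum>i\<in>dispatchers G. ennreal (arr_rate G i / (\<Sum>i\<in>dispatchers G. arr_rate G i)))"
    by (subst nn_integral_count_space'[OF finD]) auto
  also have "\<dots> = ennreal (\<Sum>i\<in>dispatchers G. arr_rate G i / (\<Sum>i\<in>dispatchers G. arr_rate G i))"
    using arr_nn arr_pos by (intro sum_ennreal) auto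
  also have "(\<Sum>i\<in>dispatchers G. arr_rate G i / (\<Sum>i\<in>dispatchers G. arr_rate G i)) = 1"
    using arr_pos by (simp flip: sum_divide_distrib)
  finally show "(\<integral>\<^sup>+i. ennreal (?f i) \<partial>count_space UNIV) = 1" by simp
qed

text \<open>The joint law of state and chosen server has first marginal \<pi>. It therefore suffices
  that \<open>B\<close> contains each state from which a task of some type can be sent to a busy
  server.\<close>

lemma queueing_prob_le:
  assumes "\<And>x i j. x \<in> set_pmf \<pi> \<Longrightarrow> i \<in> dispatchers G \<Longrightarrow> j \<in> set_pmf (A i x) \<Longrightarrow> busy x j \<Longrightarrow> x \<in> B"
  shows "queueing_prob G A \<pi> \<le> measure_pmf.prob \<pi> B"
proof -
  define J where "J = bind_pmf \<pi> (\<lambda>x. bind_pmf (new_task_pmf G) (\<lambda>i. map_pmf (\<lambda>j. (x, j)) (A i x)))"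
  have nt: "set_pmf (new_task_pmf G) \<subseteq> dispatchers G"
    by (auto simp: set_pmf_iff pmf_new_task split: if_splits)
  have "map_pmf fst J = \<pi>"
    unfolding J_def by (simp add: map_bind_pmf pmf.map_comp o_def map_pmf_const bind_return_pmf')
  then have "measure_pmf.prob \<pi> B = measure_pmf.prob J (fst -` B)"
    by (metis measure_map_pmf)
  moreover have "measure_pmf.prob J {(x, j). busy x j} \<le> measure_pmf.prob J (fst -` B)"
  proof (rule measure_pmf.finite_measure_mono_AE)
    show "AE z in measure_pmf J. z \<in> {(x, j). busy x j} \<longrightarrow> z \<in> fst -` B"
      using assms nt by (fastforce simp: AE_measure_pmf_iff J_def)
  qed auto
  ultimately show ?thesis unfolding queueing_prob_def J_def by simp
qed

end

section \<open>The Lyapunov function of a dispatcher class\<close>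

definition idle_count :: "nat set \<Rightarrow> state \<Rightarrow> nat" where
  "idle_count P x = (\<Sum>j\<in>P. of_bool (x j = []))"

text \<open>Subtraction of naturals gives 0 for an empty queue, so idle servers do not count
  negatively.\<close>

definition waiting :: "nat set \<Rightarrow> state \<Rightarrow> nat" where
  "waiting P x = (\<Sum>j\<in>P. length (x j) - 1)"

definition lyapunov :: "real \<Rightarrow> nat set \<Rightarrow> state \<Rightarrow> real" where
  "lyapunov r P x = real (waiting P x) - (\<Sum>k<idle_count P x. r ^ k)"

lemma idle_count_eq_0: "finite P \<Longrightarrow> idle_count P x = 0 \<longleftrightarrow> (\<forall>j\<in>P. busy x j)"
  by (auto simp: idle_count_def busy_def)

text \<open>Each side carries the contribution of \<open>j\<close> that the other one lacks, which
  avoids subtracting naturals. \<open>waiting_update\<close> has the same form.\<close>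

lemma idle_count_update:
  assumes "finite P" "j \<in> P"
  shows "idle_count P (x(j := q)) + of_bool (x j = []) = idle_count P x + of_bool (q = [])"
proof -
  have "(\<Sum>k\<in>P - {j}. of_bool ((x(j := q)) k = [])) = (\<Sum>k\<in>P - {j}. of_bool (x k = []) :: nat)"
    by (rule sum.cong) auto
  then show ?thesis
    using sum.remove[OF assms, of "\<lambda>k. of_bool (x k = []) :: nat"]
      sum.remove[OF assms, of "\<lambda>k. of_bool ((x(j := q)) k = []) :: nat"]
    unfolding idle_count_def by (simp del: sum_of_bool_eq)
qed

lemma waiting_update:
  assumes "finite P" "j \<in> P"
  shows "waiting P (x(j := q)) + (length (x j) - 1) = waiting P x + (length q - 1)"
proof -
  have "(\<Sum>k\<in>P - {j}. length ((x(j := q)) k) - 1) = (\<Sum>k\<in>P - {j}. length (x k) - 1)"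
    by (rule sum.cong) auto
  then show ?thesis
    using sum.remove[OF assms, of "\<lambda>k. length (x k) - 1"]
      sum.remove[OF assms, of "\<lambda>k. length ((x(j := q)) k) - 1"]
    unfolding waiting_def by simp
qed

lemma lyapunov_update_outside:
  assumes "j \<notin> P"
  shows "lyapunov r P (x(j := q)) = lyapunov r P x"
proof -
  have "waiting P (x(j := q)) = waiting P x" "idle_count P (x(j := q)) = idle_count P x"
    unfolding waiting_def idle_count_def using assms by (auto intro!: sum.cong)
  then show ?thesis by (simp add: lyapunov_def)
qed

text \<open>A task joining an idle server removes the last term of the geometric sum; one joining a
  busy server is an additional waiting task.\<close>

lemma lyapunov_arrival:
  assumes "finite P" "j \<in> P"
  shows "lyapunov r P (x(j := x j @ [i])) - lyapunov r P x
    = (if x j = [] then r ^ (idle_count P x - 1) else 1)"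
proof (cases "x j = []")
  case True
  then have "idle_count P x = Suc (idle_count P (x(j := x j @ [i])))"
    "waiting P (x(j := x j @ [i])) = waiting P x"
    using idle_count_update[OF assms, of x "x j @ [i]"] waiting_update[OF assms, of x "x j @ [i]"] by auto
  then show ?thesis using True by (simp add: lyapunov_def)
next
  case False
  then have "idle_count P (x(j := x j @ [i])) = idle_count P x"
    "waiting P (x(j := x j @ [i])) = Suc (waiting P x)"
    using idle_count_update[OF assms, of x "x j @ [i]"] waiting_update[OF assms, of x "x j @ [i]"]
    by (cases "x j"; simp)+
  then show ?thesis using False by (simp add: lyapunov_def)
qed

text \<open>A server that empties appends the next term to the geometric sum; otherwise a waiting
  task enters service.\<close>

lemma lyapunov_departure:
  assumes "finite P" "j \<in> P" "x j \<noteq> []"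
  shows "lyapunov r P (x(j := tl (x j))) - lyapunov r P x
    = (if length (x j) = 1 then - (r ^ idle_count P x) else - 1)"
proof (cases "length (x j) = 1")
  case True
  then have "tl (x j) = []" by (cases "x j") auto
  then have "idle_count P (x(j := tl (x j))) = Suc (idle_count P x)"
    "waiting P (x(j := tl (x j))) = waiting P x"
    using True assms(3) idle_count_update[OF assms(1,2), of x "tl (x j)"]
      waiting_update[OF assms(1,2), of x "tl (x j)"] by auto
  then show ?thesis using True by (simp add: lyapunov_def)
next
  case False
  then have "tl (x j) \<noteq> []" "length (x j) \<ge> 2" using assms(3)
    by (cases "x j"; auto simp: Suc_le_eq)+
  then have "idle_count P (x(j := tl (x j))) = idle_count P x"
    "Suc (waiting P (x(j := tl (x j)))) = waiting P x"
    using assms(3) idle_count_update[OF assms(1,2), of x "tl (x j)"]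
      waiting_update[OF assms(1,2), of x "tl (x j)"] by auto
  then show ?thesis using False by (simp add: lyapunov_def)
qed

text \<open>The geometric weights are what makes this bound independent of the size of the
  pool.\<close>

lemma lyapunov_lower:
  assumes "0 < r" "r < 1"
  shows "- 1 / (1 - r) \<le> lyapunov r P x"
proof -
  have "(\<Sum>k<idle_count P x. r ^ k) = (1 - r ^ idle_count P x) / (1 - r)"
    using assms one_diff_power_eq[of r "idle_count P x"] by simp
  also have "\<dots> \<le> 1 / (1 - r)"
    using assms by (intro divide_right_mono) auto
  finally show ?thesis unfolding lyapunov_def by simp
qed

lemma set_pmf_jiq:
  assumes "finite (pool i)" "pool i \<noteq> {}"
  shows "set_pmf (jiq pool i x) =
    (if \<exists>j\<in>pool i. \<not> busy x j then {j \<in> pool i. \<not> busy x j} else pool i)"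
  using assms unfolding jiq_def Let_def by (subst set_pmf_of_set) auto

section \<open>The drift of one dispatcher class under JIQ\<close>

text \<open>Types outside \<open>D\<close> have rate 0 on \<open>P\<close>, so by admissibility
  their tasks never enter \<open>P\<close> and the class evolves on its own. Within \<open>D\<close>
  the rate at a server does not depend on the type.\<close>

locale jiq_class = load_balancing G "jiq pool" for G pool +
  fixes D P :: "nat set" and \<rho> :: "nat \<Rightarrow> real"
  assumes D: "D \<subseteq> dispatchers G" and P: "P \<subseteq> servers G" "P \<noteq> {}"
    and pool: "i \<in> D \<Longrightarrow> pool i = P"
    and srv_in: "i \<in> D \<Longrightarrow> j \<in> P \<Longrightarrow> srv_rate G i j = \<rho> j"
    and srv_out: "i \<in> dispatchers G - D \<Longrightarrow> j \<in> P \<Longrightarrow> srv_rate G i j = 0"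
begin

lemma finP: "finite P"
  using P finS finite_subset by blast

text \<open>The increment is the same for every server that JIQ may choose, so the expectation is
  that of a constant.\<close>

lemma expectation_arrival:
  assumes i: "i \<in> dispatchers G"
  shows "measure_pmf.expectation (jiq pool i x) (\<lambda>j. lyapunov r P (x(j := x j @ [i]))) - lyapunov r P x
    = (if i \<in> D then if idle_count P x = 0 then 1 else r ^ (idle_count P x - 1) else 0)"
    (is "_ = ?c")
proof -
  have "lyapunov r P (x(j := x j @ [i])) = lyapunov r P x + ?c" if j: "j \<in> set_pmf (jiq pool i x)" for j
  proof (cases "i \<in> D")
    case True
    have set: "set_pmf (jiq pool i x) = (if idle_count P x = 0 then P else {j \<in> P. x j = []})"
      using set_pmf_jiq[of pool i x] finP P pool[OF True] by (auto simp: idle_count_eq_0 busy_def)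
    then have "j \<in> P" "x j = [] \<longleftrightarrow> idle_count P x \<noteq> 0"
      using j idle_count_eq_0[OF finP, of x] by (auto simp: busy_def split: if_splits)
    then show ?thesis
      using lyapunov_arrival[OF finP \<open>j \<in> P\<close>, of r x i] True by auto
  next
    case False
    then have "j \<notin> P" using admissible[OF i j] srv_out[of i j] i by auto
    then show ?thesis using False by (simp add: lyapunov_update_outside)
  qed
  then have "measure_pmf.expectation (jiq pool i x) (\<lambda>j. lyapunov r P (x(j := x j @ [i])))
      = measure_pmf.expectation (jiq pool i x) (\<lambda>j. lyapunov r P x + ?c)"
    by (intro integral_cong_AE) (auto simp: AE_measure_pmf_iff)
  then show ?thesis by simp
qed

lemma generator_lyapunov:
  assumes x: "x \<in> states G"
  shows "generator G (jiq pool) (lyapunov r P) x =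
     (\<Sum>i\<in>D. arr_rate G i) * (if idle_count P x = 0 then 1 else r ^ (idle_count P x - 1)) -
     (\<Sum>j\<in>P. \<rho> j * (if x j = [] then 0 else if length (x j) = 1 then r ^ idle_count P x else 1))"
proof -
  let ?a = "if idle_count P x = 0 then 1 else r ^ (idle_count P x - 1)"
  let ?d = "\<lambda>j. if x j = [] then 0 else if length (x j) = 1 then r ^ idle_count P x else 1"
  have "(\<Sum>i\<in>dispatchers G. arr_rate G i * (measure_pmf.expectation (jiq pool i x)
          (\<lambda>j. lyapunov r P (x(j := x j @ [i]))) - lyapunov r P x))
      = (\<Sum>i\<in>dispatchers G. if i \<in> D then arr_rate G i * ?a else 0)"
    by (intro sum.cong refl) (simp add: expectation_arrival)
  also have "\<dots> = (\<Sum>i\<in>D. arr_rate G i) * ?a"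
    using finD D by (simp add: sum.inter_restrict[symmetric] Int_absorb1 sum_distrib_right)
  finally have arr: "(\<Sum>i\<in>dispatchers G. arr_rate G i * (measure_pmf.expectation (jiq pool i x)
          (\<lambda>j. lyapunov r P (x(j := x j @ [i]))) - lyapunov r P x))
      = (\<Sum>i\<in>D. arr_rate G i) * ?a" .
  \<comment> \<open>Only the type at the head of the queue survives in the sum. A state of
    \<open>states G\<close> holds only types with positive rate, so for \<open>j\<close> in
    \<open>P\<close> this type lies in \<open>D\<close> and is served at rate
    \<open>\<rho> j\<close>.\<close>
  have one: "(\<Sum>i\<in>dispatchers G. srv_rate G i j * (if x j \<noteq> [] \<and> hd (x j) = i
        then lyapunov r P (x(j := tl (x j))) - lyapunov r P x else 0))
      = (if j \<in> P then - (\<rho> j * ?d j) else 0)" if j: "j \<in> servers G" for j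
  proof (cases "j \<in> P \<and> x j \<noteq> []")
    case True
    then have "hd (x j) \<in> dispatchers G" "0 < srv_rate G (hd (x j)) j"
      using x j unfolding states_def by auto
    then have hd: "hd (x j) \<in> dispatchers G" "srv_rate G (hd (x j)) j = \<rho> j"
      using True srv_in srv_out[of "hd (x j)" j] by (cases "hd (x j) \<in> D"; auto)+
    have "(\<Sum>i\<in>dispatchers G. srv_rate G i j * (if x j \<noteq> [] \<and> hd (x j) = i
        then lyapunov r P (x(j := tl (x j))) - lyapunov r P x else 0))
      = (\<Sum>i\<in>dispatchers G. if hd (x j) = i then srv_rate G i j *
        (lyapunov r P (x(j := tl (x j))) - lyapunov r P x) else 0)"
      using True by (intro sum.cong) auto
    also have "\<dots> = \<rho> j * (lyapunov r P (x(j := tl (x j))) - lyapunov r P x)"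
      using hd finD by simp
    finally show ?thesis
      using True lyapunov_departure[OF finP, of j x r] by simp
  next
    case False
    then show ?thesis by (auto simp: lyapunov_update_outside intro!: sum.neutral)
  qed
  have "(\<Sum>i\<in>dispatchers G. \<Sum>j\<in>servers G. srv_rate G i j * (if x j \<noteq> [] \<and> hd (x j) = i
        then lyapunov r P (x(j := tl (x j))) - lyapunov r P x else 0))
      = (\<Sum>j\<in>servers G. if j \<in> P then - (\<rho> j * ?d j) else 0)"
    by (subst sum.swap) (intro sum.cong refl one)
  also have "\<dots> = - (\<Sum>j\<in>P. \<rho> j * ?d j)"
    using finS P by (subst sum.inter_restrict[symmetric]) (auto simp: Int_absorb1 sum_negf)
  finally show ?thesis unfolding generator_def arr by simp
qed

text \<open>The first bound penalizes states without idle servers and will control queueing; the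
  second penalizes waiting tasks and will give existence. The last assumption makes the drift
  \<open>- d\<close> of a fully busy pool strong enough for the second bound too.\<close>

lemma generator_lyapunov_le:
  assumes x: "x \<in> states G"
    and r: "0 < r" "r < 1"
    and \<rho>: "\<And>j. j \<in> P \<Longrightarrow> \<rho>min \<le> \<rho> j \<and> \<rho> j \<le> \<rho>max" "0 < \<rho>min"
    and load: "(\<Sum>i\<in>D. arr_rate G i) / r + d \<le> (\<Sum>j\<in>P. \<rho> j)"
    and \<eta>: "0 \<le> \<eta>" "\<And>n. r ^ n * (\<rho>max * real n - d) \<le> \<eta>"
    and d: "(1 - r) * \<rho>min \<le> d"
  shows "generator G (jiq pool) (lyapunov r P) x \<le> \<eta> - d * of_bool (idle_count P x = 0)"
    and "generator G (jiq pool) (lyapunov r P) x \<le> \<eta> - (1 - r) * \<rho>min * of_bool (waiting P x \<noteq> 0)"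
proof -
  let ?\<Lambda> = "\<Sum>i\<in>D. arr_rate G i"
  let ?C = "\<Sum>j\<in>P. \<rho> j"
  let ?n = "idle_count P x"
  let ?L = "generator G (jiq pool) (lyapunov r P) x"
  have \<Lambda>0: "0 \<le> ?\<Lambda>" using D arr_nn by (auto intro!: sum_nonneg)
  have \<rho>0: "\<rho> j > 0" if "j \<in> P" for j using \<rho> that by force
  have d0: "0 < d" using d r \<rho>(2) by (smt (verit) mult_pos_pos)
  have busy: "?L \<le> - d" if "?n = 0"
  proof -
    have "x j \<noteq> []" if "j \<in> P" for j
      using \<open>?n = 0\<close> that idle_count_eq_0[OF finP] by (auto simp: busy_def)
    then have "?L = ?\<Lambda> - ?C"
      unfolding generator_lyapunov[OF x] using that by (auto intro!: sum.cong)
    moreover have "?\<Lambda> \<le> ?\<Lambda> / r"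
      using r \<Lambda>0 by (simp add: pos_le_divide_eq mult_left_le)
    ultimately show ?thesis using load by linarith
  qed
  have idle: "?L \<le> \<eta> - (1 - r) * \<rho>min * of_bool (waiting P x \<noteq> 0)" if n: "?n > 0"
  proof -
    have rn: "r ^ ?n \<le> r" using n r power_decreasing[of 1 ?n r] by simp
    \<comment> \<open>Filling an idle server costs \<open>r ^ (?n - 1)\<close> while freeing one
      gains only \<open>r ^ ?n\<close>; the factor \<open>1 / r\<close> between them is why the load
      enters divided by \<open>r\<close>.\<close>
    have "r ^ (?n - 1) = r ^ ?n / r" using n r by (simp add: power_diff)
    then have "?\<Lambda> * r ^ (?n - 1) = r ^ ?n * (?\<Lambda> / r)" by simp
    also have "\<dots> \<le> r ^ ?n * (?C - d)" using load r by (intro mult_left_mono) auto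
    finally have a: "?\<Lambda> * r ^ (?n - 1) \<le> r ^ ?n * (?C - d)" .
    have wait: "\<rho>min * of_bool (waiting P x \<noteq> 0) \<le> (\<Sum>j\<in>P. \<rho> j * of_bool (length (x j) \<ge> 2))"
    proof (cases "waiting P x = 0")
      case True
      then show ?thesis using \<rho>0 by (auto intro!: sum_nonneg simp: less_imp_le)
    next
      case False
      have "\<exists>k\<in>P. length (x k) \<ge> 2"
      proof (rule ccontr)
        assume "\<not> (\<exists>k\<in>P. length (x k) \<ge> 2)"
        then have "waiting P x = 0" unfolding waiting_def by (intro sum.neutral) force
        with False show False by contradiction
      qed
      then obtain k where k: "k \<in> P" "length (x k) \<ge> 2" by blast
      have "\<rho> k * of_bool (length (x k) \<ge> 2) \<le> (\<Sum>j\<in>P. \<rho> j * of_bool (length (x j) \<ge> 2))"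
        using \<rho>0 finP k by (intro member_le_sum) (auto simp: less_imp_le)
      then show ?thesis using k False \<rho>(1)[of k] by simp
    qed
    have "r ^ ?n * (\<Sum>j\<in>P. \<rho> j * of_bool (x j = [])) \<le> r ^ ?n * (\<rho>max * real ?n)"
    proof (intro mult_left_mono)
      have "(\<Sum>j\<in>P. \<rho> j * of_bool (x j = [])) \<le> (\<Sum>j\<in>P. \<rho>max * of_bool (x j = []))"
        using \<rho> by (intro sum_mono mult_right_mono) auto
      then show "(\<Sum>j\<in>P. \<rho> j * of_bool (x j = [])) \<le> \<rho>max * real ?n"
        by (simp only: idle_count_def of_nat_sum sum_distrib_left of_nat_of_bool)
    qed (use r in auto)
    \<comment> \<open>Each busy server contributes at least \<open>r ^ ?n\<close> times its rate.
      One with two or more tasks contributes its full rate, and \<open>1 >= r ^ ?n + (1 - r)\<close>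
      because \<open>?n > 0\<close>.\<close>
    moreover have "r ^ ?n * ?C - r ^ ?n * (\<Sum>j\<in>P. \<rho> j * of_bool (x j = []))
        + (1 - r) * (\<Sum>j\<in>P. \<rho> j * of_bool (length (x j) \<ge> 2))
      \<le> (\<Sum>j\<in>P. \<rho> j * (if x j = [] then 0 else if length (x j) = 1 then r ^ ?n else 1))"
      unfolding sum_distrib_left sum_subtractf[symmetric] sum.distrib[symmetric]
    proof (rule sum_mono)
      fix j assume "j \<in> P"
      have "r ^ ?n * \<rho> j + (1 - r) * \<rho> j \<le> \<rho> j"
        using mult_right_mono[OF rn, of "\<rho> j"] \<rho>0[OF \<open>j \<in> P\<close>] by (simp add: algebra_simps)
      moreover have "length (x j) \<noteq> 0 \<Longrightarrow> length (x j) \<noteq> 1 \<Longrightarrow> 2 \<le> length (x j)" by linarith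
      ultimately show "r ^ ?n * \<rho> j - r ^ ?n * (\<rho> j * of_bool (x j = []))
          + (1 - r) * (\<rho> j * of_bool (length (x j) \<ge> 2))
        \<le> \<rho> j * (if x j = [] then 0 else if length (x j) = 1 then r ^ ?n else 1)"
        by auto
    qed
    moreover have "(1 - r) * (\<rho>min * of_bool (waiting P x \<noteq> 0))
        \<le> (1 - r) * (\<Sum>j\<in>P. \<rho> j * of_bool (length (x j) \<ge> 2))"
      using wait r by (intro mult_left_mono) auto
    moreover have "?L = ?\<Lambda> * r ^ (?n - 1)
        - (\<Sum>j\<in>P. \<rho> j * (if x j = [] then 0 else if length (x j) = 1 then r ^ ?n else 1))"
      unfolding generator_lyapunov[OF x] using n by simp
    ultimately show ?thesis using a \<eta>(2)[of ?n] by (simp add: algebra_simps)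
  qed
  have c0: "0 \<le> (1 - r) * \<rho>min" using r \<rho>(2) by simp
  show "?L \<le> \<eta> - d * of_bool (?n = 0)"
    using busy idle c0 \<eta>(1) by (cases "?n = 0"; cases "waiting P x = 0") auto
  show "?L \<le> \<eta> - (1 - r) * \<rho>min * of_bool (waiting P x \<noteq> 0)"
    using busy idle c0 \<eta>(1) d d0 by (cases "?n = 0"; cases "waiting P x = 0") auto
qed

end

text \<open>From some \<open>n0\<close> on, \<open>r ^ n * (B * n)\<close> is below \<eta> by
  itself; for smaller \<open>n\<close> the bracket is nonpositive once \<open>d >= B * n0\<close>.
  The threshold for \<open>d\<close> is thus uniform in \<open>n\<close>.\<close>

lemma power_times_affine_small:
  fixes r \<eta> B :: real
  assumes "0 < r" "r < 1" "0 < \<eta>" "0 < B"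
  shows "\<forall>\<^sub>F d in at_top. \<forall>n. r ^ n * (B * real n - d) \<le> \<eta>"
proof -
  have "(\<lambda>n. r ^ n * (B * real n)) \<longlonglongrightarrow> 0"
    using assms(1,2) by real_asymp
  then have "\<forall>\<^sub>F n in sequentially. r ^ n * (B * real n) < \<eta>"
    using assms(3) by (rule order_tendstoD)
  then obtain n0 where n0: "\<And>n. n \<ge> n0 \<Longrightarrow> r ^ n * (B * real n) < \<eta>"
    by (auto simp: eventually_sequentially)
  have "r ^ n * (B * real n - d) \<le> \<eta>" if d: "d \<ge> B * real n0" for d n
  proof (cases "n \<ge> n0")
    case True
    have "0 \<le> B * real n0" using assms by simp
    then have "0 \<le> r ^ n * d" using d assms(1) by (intro mult_nonneg_nonneg) auto
    then show ?thesis using n0[OF True] by (simp add: right_diff_distrib)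
  next
    case False
    then have "B * real n \<le> B * real n0" using assms by simp
    then have "B * real n - d \<le> 0" using d by linarith
    then have "r ^ n * (B * real n - d) \<le> 0" using assms(1) by (intro mult_nonneg_nonpos) auto
    then show ?thesis using assms by linarith
  qed
  then show ?thesis unfolding eventually_at_top_linorder by blast
qed

section \<open>The ICRD sub-systems\<close>

lemma is_partition_mono:
  assumes "is_partition K u" "k \<le> l" "l \<le> K"
  shows "u k \<le> u l"
  using assms(2,3)
proof (induction l rule: dec_induct)
  case base
  then show ?case by simp
next
  case (step l)
  then have "u (Suc l - 1) < u (Suc l)"
    using assms(1) unfolding is_partition_def by (metis atLeastAtMost_iff le_add1 plus_1_eq_Suc)
  then show ?case using step by simp
qed

text \<open>The cell of \<open>x\<close> ends at the first partition point beyond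
  \<open>x\<close>.\<close>

lemma is_partition_cell_exists:
  assumes "is_partition K u" "x \<in> {0..<1}"
  shows "\<exists>k\<in>{1..K}. x \<in> cell u k"
proof -
  define k where "k = (LEAST k. x < u k)"
  have K: "x < u K" and 0: "\<not> x < u 0" using assms by (auto simp: is_partition_def)
  have k: "x < u k" "k \<le> K" unfolding k_def using K by (auto intro: LeastI Least_le)
  have "k \<noteq> 0" using k 0 by (metis)
  moreover have "\<not> x < u (k - 1)"
    using not_less_Least[of "k - 1" "\<lambda>k. x < u k"] \<open>k \<noteq> 0\<close> unfolding k_def[symmetric] by simp
  ultimately show ?thesis using k by (auto simp: cell_def intro!: bexI[of _ k])
qed

lemma is_partition_cell_unique:
  assumes "is_partition K u" "k \<in> {1..K}" "l \<in> {1..K}" "x \<in> cell u k" "x \<in> cell u l"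
  shows "k = l"
proof -
  have "\<not> k < l" if "k \<in> {1..K}" "l \<in> {1..K}" "x \<in> cell u k" "x \<in> cell u l" for k l
  proof
    assume "k < l"
    then have "u k \<le> u (l - 1)" using that by (intro is_partition_mono[OF assms(1)]) auto
    then show False using that by (auto simp: cell_def)
  qed
  then show ?thesis using assms by (metis linorder_neqE_nat)
qed

section \<open>Classes, pools and service rates of the ICRD sub-systems\<close>

locale icrd_setting =
  fixes f :: "real \<Rightarrow> real \<Rightarrow> real"
    and \<phi>1 \<phi>2 :: "nat \<Rightarrow> real"
    and G :: "nat \<Rightarrow> lb_system"
    and H M :: nat
    and w v :: "nat \<Rightarrow> real"
    and \<mu> :: "nat \<Rightarrow> nat \<Rightarrow> real"
    and \<Lambda> :: "nat \<Rightarrow> real"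
    and p \<epsilon> :: "nat \<Rightarrow> nat \<Rightarrow> real"
    and S :: "nat \<Rightarrow> nat \<Rightarrow> nat \<Rightarrow> nat set"
  assumes fseq: "f_sequence f \<phi>1 \<phi>2 G"
    and stepw: "stepwise f H w M v \<mu>"
    and subc: "subcritical \<phi>1 \<phi>2 G H w M v \<mu> \<Lambda> p"
    and poly: "\<epsilon> \<in> icrd_Poly H M v \<mu> \<Lambda> p"
    and division: "\<forall>\<^sub>F N in sequentially. icrd_division \<phi>2 H M v \<mu> \<Lambda> p \<epsilon> N (G N) (S N)"
begin

abbreviation "D N h \<equiv> disp_class \<phi>1 w (G N) h"

abbreviation "Gt N \<equiv> icrd \<phi>1 H w M \<mu> (G N) (S N)"

abbreviation "pool N \<equiv> icrd_pool \<phi>1 H w M (G N) (S N)"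

abbreviation "divided N \<equiv> icrd_division \<phi>2 H M v \<mu> \<Lambda> p \<epsilon> N (G N) (S N)"

definition P :: "nat \<Rightarrow> nat \<Rightarrow> nat set" where
  "P N h = (\<Union>m\<in>{1..M}. S N h m)"

text \<open>Under \<open>divided N\<close> at most one summand is nonzero, and off the pool the
  value is 0.\<close>

definition \<rho> :: "nat \<Rightarrow> nat \<Rightarrow> nat \<Rightarrow> real" where
  "\<rho> N h j = (\<Sum>m=1..M. if j \<in> S N h m then \<mu> h m else 0)"

lemma partw: "is_partition H w" and partv: "is_partition M v"
  using stepw by (auto simp: stepwise_def)

lemma H_pos: "H \<ge> 1"
  using partw by (cases H) (auto simp: is_partition_def)

lemma p_bounds: "h \<in> {1..H} \<Longrightarrow> m \<in> {1..M} \<Longrightarrow> 0 \<le> p h m"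
  using subc by (auto simp: subcritical_def)

lemma \<mu>_nn: "h \<in> {1..H} \<Longrightarrow> m \<in> {1..M} \<Longrightarrow> 0 \<le> \<mu> h m"
  using stepw by (auto simp: stepwise_def)

lemma \<Lambda>_pos: "h \<in> {1..H} \<Longrightarrow> 0 < \<Lambda> h"
  using subc by (auto simp: subcritical_def)

text \<open>With \<open>\<mu> h m = 0\<close> the quotient for \<open>h\<close> in the load
  condition would be infinite, and as the others are nonnegative the sum could not be below
  1.\<close>

lemma \<mu>_pos:
  assumes h: "h \<in> {1..H}" and m: "m \<in> {1..M}" and p: "p h m > 0"
  shows "\<mu> h m > 0"
proof (rule ccontr)
  assume "\<not> \<mu> h m > 0"
  then have \<mu>0: "\<mu> h m = 0" using \<mu>_nn[OF h m] by simp
  let ?t = "\<lambda>h. ereal (\<Lambda> h * p h m) / ereal (\<mu> h m * (v m - v (m - 1)))"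
  have vm: "v (m - 1) < v m" using partv m by (auto simp: is_partition_def)
  have nn: "0 \<le> ?t h'" if "h' \<in> {1..H}" for h'
    using \<Lambda>_pos[OF that] p_bounds[OF that m] \<mu>_nn[OF that m] vm by (simp add: zero_le_divide_ereal)
  have "?t h = \<infinity>" using \<mu>0 \<Lambda>_pos[OF h] p by (simp add: divide_ereal_def)
  moreover have "(\<Sum>h=1..H. ?t h) = ?t h + (\<Sum>h\<in>{1..H} - {h}. ?t h)"
    using h by (intro sum.remove) auto
  moreover have "0 \<le> (\<Sum>h\<in>{1..H} - {h}. ?t h)"
    by (rule sum_nonneg) (use nn in blast)
  ultimately have "(\<Sum>h=1..H. ?t h) = \<infinity>" by auto
  moreover have "(\<Sum>h=1..H. ?t h) < 1" using subc m by (auto simp: subcritical_def)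
  ultimately show False by simp
qed

lemma \<epsilon>_pos: "h \<in> {1..H} \<Longrightarrow> m \<in> {1..M} \<Longrightarrow> p h m > 0 \<Longrightarrow> \<epsilon> h m > 0"
  and \<epsilon>_zero: "h \<in> {1..H} \<Longrightarrow> m \<in> {1..M} \<Longrightarrow> p h m = 0 \<Longrightarrow> \<epsilon> h m = 0"
  using poly unfolding icrd_Poly_def by fastforce+

lemma p_pos_exists:
  assumes "h \<in> {1..H}"
  shows "\<exists>m\<in>{1..M}. p h m > 0"
proof (rule ccontr)
  assume "\<not> ?thesis"
  then have "(\<Sum>m=1..M. p h m) \<le> 0" by (intro sum_nonpos) force
  then show False using subc assms by (auto simp: subcritical_def)
qed

lemma fin_dispatchers: "finite (dispatchers (G N))" and servers_eq: "servers (G N) = {1..N}"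
  and arr_nonneg: "i \<in> dispatchers (G N) \<Longrightarrow> 0 \<le> arr_rate (G N) i"
  using fseq by (auto simp: f_sequence_def)

lemma disp_class_exists:
  assumes "i \<in> dispatchers (G N)"
  obtains h where "h \<in> {1..H}" "i \<in> D N h"
proof -
  have "\<phi>1 i \<in> {0..<1}" using fseq unfolding f_sequence_def by blast
  from is_partition_cell_exists[OF partw this] obtain h where "h \<in> {1..H}" "\<phi>1 i \<in> cell w h" ..
  then show thesis using assms that by (simp add: disp_class_def)
qed

lemma disp_class_unique: "h \<in> {1..H} \<Longrightarrow> h' \<in> {1..H} \<Longrightarrow> i \<in> D N h \<Longrightarrow> i \<in> D N h' \<Longrightarrow> h = h'"
  unfolding disp_class_def by (blast intro: is_partition_cell_unique[OF partw])

lemma pool_eq: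
  assumes "h \<in> {1..H}" "i \<in> D N h"
  shows "pool N i = P N h"
proof -
  have "{h\<in>{1..H}. i \<in> D N h} = {h}" using assms disp_class_unique by blast
  then show ?thesis by (simp add: icrd_pool_def P_def)
qed

lemma srv_rate_eq:
  assumes "h \<in> {1..H}" "i \<in> D N h"
  shows "srv_rate (Gt N) i j = \<rho> N h j"
proof -
  have "srv_rate (Gt N) i j
      = (\<Sum>h'=1..H. \<Sum>m=1..M. if i \<in> D N h' \<and> j \<in> S N h' m then \<mu> h' m else 0)"
    by (simp add: icrd_def)
  also have "\<dots> = (\<Sum>h'=1..H. if h' = h then \<rho> N h j else 0)"
  proof (rule sum.cong[OF refl])
    fix h' assume "h' \<in> {1..H}"
    then have "i \<in> D N h' \<longleftrightarrow> h' = h" using assms disp_class_unique by blast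
    then show "(\<Sum>m=1..M. if i \<in> D N h' \<and> j \<in> S N h' m then \<mu> h' m else 0)
        = (if h' = h then \<rho> N h j else 0)"
      by (auto simp: \<rho>_def)
  qed
  also have "\<dots> = \<rho> N h j" using assms by simp
  finally show ?thesis .
qed

lemma S_subset: "divided N \<Longrightarrow> h \<in> {1..H} \<Longrightarrow> m \<in> {1..M} \<Longrightarrow> S N h m \<subseteq> serv_class \<phi>2 v (G N) m"
  by (auto simp: icrd_division_def)

lemma S_card: "divided N \<Longrightarrow> h \<in> {1..H} \<Longrightarrow> m \<in> {1..M} \<Longrightarrow>
    card (S N h m) = nat \<lfloor>real N * (\<Lambda> h * p h m / \<mu> h m + \<epsilon> h m)\<rfloor>"
  by (auto simp: icrd_division_def)

lemma finite_S: "divided N \<Longrightarrow> h \<in> {1..H} \<Longrightarrow> m \<in> {1..M} \<Longrightarrow> finite (S N h m)"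
  using S_subset by (rule finite_subset) (auto simp: serv_class_def servers_eq)

text \<open>The server class of \<open>j\<close> determines \<open>m\<close>, since cells are
  disjoint; within that class the division determines \<open>h\<close>.\<close>

lemma S_unique:
  assumes "divided N" "h \<in> {1..H}" "m \<in> {1..M}" "h' \<in> {1..H}" "m' \<in> {1..M}"
    and "j \<in> S N h m" "j \<in> S N h' m'"
  shows "h = h' \<and> m = m'"
proof -
  have "j \<in> serv_class \<phi>2 v (G N) m" "j \<in> serv_class \<phi>2 v (G N) m'" using S_subset assms by blast+
  then have m: "m = m'"
    unfolding serv_class_def by (blast intro: is_partition_cell_unique[OF partv assms(3,5)])
  have "disjoint_family_on (\<lambda>h. S N h m) {1..H}" using assms by (auto simp: icrd_division_def)
  then show ?thesis using assms m unfolding disjoint_family_on_def by blast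
qed

lemma \<rho>_eq:
  assumes "divided N" "h \<in> {1..H}" "m \<in> {1..M}" "j \<in> S N h m"
  shows "\<rho> N h j = \<mu> h m"
proof -
  have "j \<in> S N h m' \<longleftrightarrow> m' = m" if "m' \<in> {1..M}" for m'
    using S_unique[OF assms(1-3) assms(2) that assms(4)] assms(4) by blast
  then have "\<rho> N h j = (\<Sum>m'=1..M. if m' = m then \<mu> h m else 0)"
    unfolding \<rho>_def by (intro sum.cong) auto
  then show ?thesis using assms by simp
qed

lemma \<rho>_outside: "j \<notin> P N h \<Longrightarrow> \<rho> N h j = 0"
  by (auto simp: \<rho>_def P_def intro!: sum.neutral)

text \<open>If \<open>p h m = 0\<close> then \<open>\<epsilon> h m = 0\<close> by proportionality,
  and the part has \<open>floor 0\<close> elements. A nonempty part thus has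
  \<open>p h m > 0\<close>.\<close>

lemma S_\<mu>_pos:
  assumes "divided N" "h \<in> {1..H}" "m \<in> {1..M}" "j \<in> S N h m"
  shows "\<mu> h m > 0"
proof (cases "p h m = 0")
  case True
  then have "card (S N h m) = 0" using S_card[OF assms(1-3)] \<epsilon>_zero[OF assms(2,3)] by simp
  then show ?thesis using assms finite_S by auto
next
  case False
  then show ?thesis using \<mu>_pos[OF assms(2,3)] p_bounds[OF assms(2,3)] by simp
qed

lemma capacity_eq:
  assumes "divided N" "h \<in> {1..H}"
  shows "(\<Sum>j\<in>P N h. \<rho> N h j) = (\<Sum>m=1..M. \<mu> h m * real (card (S N h m)))"
proof -
  have "S N h m \<inter> S N h m' = {}" if "m \<in> {1..M}" "m' \<in> {1..M}" "m \<noteq> m'" for m m'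
    using S_unique[OF assms that(1) assms(2) that(2)] that(3) by blast
  then have "(\<Sum>j\<in>P N h. \<rho> N h j) = (\<Sum>m\<in>{1..M}. \<Sum>j\<in>S N h m. \<rho> N h j)"
    unfolding P_def using finite_S[OF assms] by (intro sum.UNION_disjoint ballI impI) blast+
  also have "\<dots> = (\<Sum>m\<in>{1..M}. \<Sum>j\<in>S N h m. \<mu> h m)"
    by (intro sum.cong refl \<rho>_eq[OF assms])
  also have "\<dots> = (\<Sum>m=1..M. \<mu> h m * real (card (S N h m)))"
    by (simp add: mult.commute)
  finally show ?thesis .
qed

section \<open>Capacity and load of the pools on the scale of \<open>N\<close>\<close>

text \<open>The limiting capacity of a pool per unit of \<open>N\<close>, multiplied out so that no
  division by \<open>\<mu> h m\<close> remains.\<close>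

definition cap :: "nat \<Rightarrow> real" where
  "cap h = (\<Sum>m=1..M. \<Lambda> h * p h m + \<mu> h m * \<epsilon> h m)"

lemma card_limit:
  assumes "h \<in> {1..H}" "m \<in> {1..M}"
  shows "(\<lambda>N. \<mu> h m * real (card (S N h m)) / real N) \<longlonglongrightarrow> \<Lambda> h * p h m + \<mu> h m * \<epsilon> h m"
proof -
  define a where "a = \<Lambda> h * p h m / \<mu> h m + \<epsilon> h m"
  have a0: "a \<ge> 0"
    using assms \<Lambda>_pos p_bounds \<mu>_nn poly
    by (auto simp: a_def icrd_Poly_def less_imp_le intro!: add_nonneg_nonneg divide_nonneg_nonneg)
  have "(\<lambda>N. real (nat \<lfloor>real N * a\<rfloor>) / real N) \<longlonglongrightarrow> a"
  proof (rule tendsto_sandwich)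
    show "\<forall>\<^sub>F N in sequentially. a - 1 / real N \<le> real (nat \<lfloor>real N * a\<rfloor>) / real N"
      using eventually_gt_at_top[of 0]
    proof eventually_elim
      case (elim N)
      have "real N * a - 1 \<le> real (nat \<lfloor>real N * a\<rfloor>)" by linarith
      then have "(real N * a - 1) / real N \<le> real (nat \<lfloor>real N * a\<rfloor>) / real N"
        by (rule divide_right_mono) simp
      then show ?case using elim by (simp add: diff_divide_distrib)
    qed
    show "\<forall>\<^sub>F N in sequentially. real (nat \<lfloor>real N * a\<rfloor>) / real N \<le> a"
      using eventually_gt_at_top[of 0]
    proof eventually_elim
      case (elim N)
      have "real (nat \<lfloor>real N * a\<rfloor>) \<le> real N * a" using a0 by (intro of_nat_floor) auto
      then show ?case using elim by (simp add: field_simps)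
    qed
    show "(\<lambda>N. a - 1 / real N) \<longlonglongrightarrow> a" by real_asymp
  qed auto
  then have "(\<lambda>N. \<mu> h m * (real (nat \<lfloor>real N * a\<rfloor>) / real N)) \<longlonglongrightarrow> \<mu> h m * a"
    by (intro tendsto_intros)
  moreover have "\<forall>\<^sub>F N in sequentially.
      \<mu> h m * (real (nat \<lfloor>real N * a\<rfloor>) / real N) = \<mu> h m * real (card (S N h m)) / real N"
    using division by eventually_elim (use assms S_card in \<open>simp add: a_def\<close>)
  \<comment> \<open>For \<open>p h m = 0\<close> both sides vanish together with
    \<open>\<epsilon> h m\<close>, whatever \<open>\<mu> h m\<close> is.\<close>
  moreover have "\<mu> h m * a = \<Lambda> h * p h m + \<mu> h m * \<epsilon> h m"
  proof (cases "p h m = 0")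
    case False
    then have "\<mu> h m > 0" using \<mu>_pos p_bounds assms by (metis order_le_less)
    then show ?thesis by (simp add: a_def field_simps)
  qed (use \<epsilon>_zero assms in \<open>simp add: a_def\<close>)
  ultimately show ?thesis using Lim_transform_eventually by fastforce
qed

lemma capacity_limit:
  assumes "h \<in> {1..H}"
  shows "(\<lambda>N. (\<Sum>j\<in>P N h. \<rho> N h j) / real N) \<longlonglongrightarrow> cap h"
proof -
  have "(\<lambda>N. \<Sum>m=1..M. \<mu> h m * real (card (S N h m)) / real N) \<longlonglongrightarrow> cap h"
    unfolding cap_def by (intro tendsto_sum card_limit assms)
  moreover have "\<forall>\<^sub>F N in sequentially. (\<Sum>m=1..M. \<mu> h m * real (card (S N h m)) / real N)
      = (\<Sum>j\<in>P N h. \<rho> N h j) / real N"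
    using division by eventually_elim (simp add: capacity_eq[OF _ assms] sum_divide_distrib)
  ultimately show ?thesis by (rule Lim_transform_eventually)
qed

text \<open>The row sum of \<open>p\<close> turns the first part of \<open>cap h\<close> into
  \<open>\<Lambda> h\<close>. The rest is nonnegative, and positive at an \<open>m\<close> with
  \<open>p h m > 0\<close>.\<close>

lemma cap_gt:
  assumes h: "h \<in> {1..H}"
  shows "\<Lambda> h < cap h"
proof -
  obtain m where m: "m \<in> {1..M}" "p h m > 0" using p_pos_exists[OF h] by blast
  have "0 < (\<Sum>m=1..M. \<mu> h m * \<epsilon> h m)"
  proof (rule sum_pos2[OF _ m(1)])
    show "0 < \<mu> h m * \<epsilon> h m" using \<mu>_pos[OF h m] \<epsilon>_pos[OF h m] by simp
    show "0 \<le> \<mu> h m * \<epsilon> h m" if "m \<in> {1..M}" for m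
      using \<mu>_nn[OF h that] \<epsilon>_pos[OF h that] \<epsilon>_zero[OF h that] p_bounds[OF h that]
      by (cases "p h m = 0") auto
  qed simp
  moreover have "(\<Sum>m=1..M. \<Lambda> h * p h m) = \<Lambda> h"
    using subc h by (simp add: subcritical_def flip: sum_distrib_left)
  ultimately show ?thesis by (simp add: cap_def sum.distrib)
qed

lemma arrival_limit: "h \<in> {1..H} \<Longrightarrow> (\<lambda>N. (\<Sum>i\<in>D N h. arr_rate (G N) i) / real N) \<longlonglongrightarrow> \<Lambda> h"
  using subc by (auto simp: subcritical_def)

text \<open>As \<open>\<Lambda> h < cap h\<close>, an \<open>r\<close> strictly between
  \<open>\<Lambda> h / cap h\<close> and 1 still leaves \<open>\<Lambda> h / r < cap h\<close>. Any
  \<kappa> below that gap works for large \<open>N\<close>.\<close>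

lemma load_exists:
  assumes h: "h \<in> {1..H}"
  shows "\<exists>r \<kappa>. 0 < r \<and> r < 1 \<and> 0 < \<kappa> \<and> (\<forall>\<^sub>F N in sequentially.
    (\<Sum>i\<in>D N h. arr_rate (G N) i) / r + \<kappa> * real N \<le> (\<Sum>j\<in>P N h. \<rho> N h j))"
proof -
  have pos: "0 < \<Lambda> h" "\<Lambda> h < cap h" using \<Lambda>_pos cap_gt h by auto
  then have "\<Lambda> h / cap h < 1" by simp
  then obtain r where r: "\<Lambda> h / cap h < r" "r < 1" using dense by blast
  have "0 < \<Lambda> h / cap h" using pos by simp
  then have r0: "0 < r" using r by linarith
  have "\<Lambda> h / r < cap h" using r r0 pos by (simp add: field_simps)
  then obtain \<kappa> where \<kappa>: "0 < \<kappa>" "\<kappa> < cap h - \<Lambda> h / r" using dense[of 0 "cap h - \<Lambda> h / r"] by auto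
  have "(\<lambda>N. (\<Sum>j\<in>P N h. \<rho> N h j) / real N - (\<Sum>i\<in>D N h. arr_rate (G N) i) / real N / r)
      \<longlonglongrightarrow> cap h - \<Lambda> h / r"
    using r0 by (intro tendsto_intros capacity_limit arrival_limit h) auto
  from order_tendstoD(1)[OF this \<kappa>(2)]
  have "\<forall>\<^sub>F N in sequentially.
    (\<Sum>i\<in>D N h. arr_rate (G N) i) / r + \<kappa> * real N \<le> (\<Sum>j\<in>P N h. \<rho> N h j)"
    using eventually_gt_at_top[of 0]
  proof eventually_elim
    case (elim N)
    then have "\<kappa> * real N < ((\<Sum>j\<in>P N h. \<rho> N h j) / real N
        - (\<Sum>i\<in>D N h. arr_rate (G N) i) / real N / r) * real N"
      by (intro mult_strict_right_mono) auto
    also have "\<dots> = (\<Sum>j\<in>P N h. \<rho> N h j) - (\<Sum>i\<in>D N h. arr_rate (G N) i) / r"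
      using elim r0 by (simp add: left_diff_distrib)
    finally show ?case by simp
  qed
  then show ?thesis using r r0 \<kappa> by blast
qed

lemma arrivals_pos:
  assumes "h \<in> {1..H}"
  shows "\<forall>\<^sub>F N in sequentially. 0 < (\<Sum>i\<in>D N h. arr_rate (G N) i)"
  using order_tendstoD(1)[OF arrival_limit[OF assms] \<Lambda>_pos[OF assms]]
  by (rule eventually_mono) (simp add: zero_less_divide_iff)

lemma capacity_pos:
  assumes "h \<in> {1..H}"
  shows "\<forall>\<^sub>F N in sequentially. 0 < (\<Sum>j\<in>P N h. \<rho> N h j)"
proof -
  have "0 < cap h" using cap_gt[OF assms] \<Lambda>_pos[OF assms] by linarith
  from order_tendstoD(1)[OF capacity_limit[OF assms] this]
  show ?thesis by (rule eventually_mono) (simp add: zero_less_divide_iff)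
qed

section \<open>The sub-systems for large \<open>N\<close> as instances of the general theory\<close>

text \<open>Positive capacity forces nonempty pools, where JIQ is well defined; positive arrivals
  make the total rate positive.\<close>

definition regular :: "nat \<Rightarrow> bool" where
  "regular N \<longleftrightarrow> divided N \<and> (\<forall>h\<in>{1..H}. 0 < (\<Sum>i\<in>D N h. arr_rate (G N) i)
     \<and> 0 < (\<Sum>j\<in>P N h. \<rho> N h j))"

lemma eventually_regular: "\<forall>\<^sub>F N in sequentially. regular N"
  unfolding regular_def
  by (intro eventually_conj division eventually_ball_finite ballI arrivals_pos capacity_pos) auto

context
  fixes N assumes N: "regular N"
begin

lemma N_div: "divided N" using N by (simp add: regular_def)

lemma P_nonempty: "h \<in> {1..H} \<Longrightarrow> P N h \<noteq> {}"
  using N unfolding regular_def by (metis less_irrefl sum.empty)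

lemma P_servers: "h \<in> {1..H} \<Longrightarrow> P N h \<subseteq> servers (Gt N)"
  using S_subset[OF N_div] by (fastforce simp: P_def icrd_def serv_class_def)

lemma finite_P: "h \<in> {1..H} \<Longrightarrow> finite (P N h)"
  using finite_S[OF N_div] by (auto simp: P_def)

lemma \<rho>_pos: "h \<in> {1..H} \<Longrightarrow> j \<in> P N h \<Longrightarrow> 0 < \<rho> N h j"
  using \<rho>_eq[OF N_div] S_\<mu>_pos[OF N_div] by (force simp: P_def)

lemma load_balancing_regular: "load_balancing (Gt N) (jiq (pool N))"
proof
  show "finite (dispatchers (Gt N))" "finite (servers (Gt N))"
    using fin_dispatchers servers_eq by (auto simp: icrd_def)
  show "0 \<le> arr_rate (Gt N) i" if "i \<in> dispatchers (Gt N)" for i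
    using that arr_nonneg by (auto simp: icrd_def)
  show "0 \<le> srv_rate (Gt N) i j" if i: "i \<in> dispatchers (Gt N)" for i j
  proof -
    have "i \<in> dispatchers (G N)" using i by (simp add: icrd_def)
    then obtain h where h: "h \<in> {1..H}" "i \<in> D N h" by (rule disp_class_exists)
    then show ?thesis
      unfolding srv_rate_eq[OF h] using \<rho>_pos[of h j] \<rho>_outside[of j N h]
      by (cases "j \<in> P N h") auto
  qed
  show "0 < (\<Sum>i\<in>dispatchers (Gt N). arr_rate (Gt N) i)"
  proof -
    have "0 < (\<Sum>i\<in>D N 1. arr_rate (G N) i)" using N H_pos by (auto simp: regular_def)
    also have "\<dots> \<le> (\<Sum>i\<in>dispatchers (G N). arr_rate (G N) i)"
      using fin_dispatchers arr_nonneg by (intro sum_mono2) (auto simp: disp_class_def)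
    finally show ?thesis by (simp add: icrd_def)
  qed
  show "j \<in> servers (Gt N) \<and> 0 < srv_rate (Gt N) i j"
    if i: "i \<in> dispatchers (Gt N)" and j: "j \<in> set_pmf (jiq (pool N) i x)" for i j x
  proof -
    have "i \<in> dispatchers (G N)" using i by (simp add: icrd_def)
    then obtain h where h: "h \<in> {1..H}" "i \<in> D N h" by (rule disp_class_exists)
    have "set_pmf (jiq (pool N) i x) \<subseteq> P N h"
      using set_pmf_jiq[of "pool N" i x] finite_P[OF h(1)] P_nonempty[OF h(1)]
      unfolding pool_eq[OF h] by auto
    then show ?thesis using j \<rho>_pos[OF h(1)] P_servers[OF h(1)] srv_rate_eq[OF h] by auto
  qed
qed

text \<open>Pools of different dispatcher classes are disjoint by \<open>S_unique\<close>, so a type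
  of another class has rate 0 on this pool.\<close>

lemma jiq_class_regular:
  assumes h: "h \<in> {1..H}"
  shows "jiq_class (Gt N) (pool N) (D N h) (P N h) (\<rho> N h)"
proof -
  interpret load_balancing "Gt N" "jiq (pool N)" by (rule load_balancing_regular)
  show ?thesis
  proof
    show "D N h \<subseteq> dispatchers (Gt N)" by (auto simp: disp_class_def icrd_def)
    show "srv_rate (Gt N) i j = 0" if i: "i \<in> dispatchers (Gt N) - D N h" and j: "j \<in> P N h" for i j
    proof -
      have "i \<in> dispatchers (G N)" using i by (simp add: icrd_def)
      then obtain h' where h': "h' \<in> {1..H}" "i \<in> D N h'" by (rule disp_class_exists)
      then have "h' \<noteq> h" using i by auto
      have "j \<notin> P N h'"
      proof
        assume "j \<in> P N h'"
        then obtain m m' where "m \<in> {1..M}" "j \<in> S N h m" "m' \<in> {1..M}" "j \<in> S N h' m'"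
          using j unfolding P_def by blast
        then show False using S_unique[OF N_div h _ h'(1)] \<open>h' \<noteq> h\<close> by blast
      qed
      then show ?thesis by (simp add: srv_rate_eq[OF h'] \<rho>_outside)
    qed
  qed (use h P_servers P_nonempty pool_eq srv_rate_eq in auto)
qed

text \<open>A server with a task lies in the pool of that task's class, because the rate is
  positive. Without waiting tasks every queue is thus empty or a single task, which leaves finitely
  many states.\<close>

lemma finite_nonwaiting: "finite {x \<in> states (Gt N). \<forall>h\<in>{1..H}. waiting (P N h) x = 0}"
proof (rule finite_subset)
  let ?B = "insert [] ((\<lambda>i. [i]) ` dispatchers (Gt N))"
  show "{x \<in> states (Gt N). \<forall>h\<in>{1..H}. waiting (P N h) x = 0}
      \<subseteq> {x. \<forall>j. (j \<in> servers (Gt N) \<longrightarrow> x j \<in> ?B) \<and> (j \<notin> servers (Gt N) \<longrightarrow> x j = [])}"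
  proof safe
    fix x j assume x: "x \<in> states (Gt N)" and w: "\<forall>h\<in>{1..H}. waiting (P N h) x = 0"
    show "x j = []" if "j \<notin> servers (Gt N)" using that x by (auto simp: states_def)
    assume j: "j \<in> servers (Gt N)" and ni: "x j \<notin> (\<lambda>i. [i]) ` dispatchers (Gt N)"
    show "x j = []"
    proof (rule ccontr)
      assume "x j \<noteq> []"
      then obtain i l where il: "x j = i # l" by (cases "x j") auto
      then have i: "i \<in> dispatchers (Gt N)" "0 < srv_rate (Gt N) i j"
        using x j by (auto simp: states_def)
      then have "i \<in> dispatchers (G N)" by (simp add: icrd_def)
      then obtain h where h: "h \<in> {1..H}" "i \<in> D N h" by (rule disp_class_exists)
      have "j \<in> P N h" using i(2) srv_rate_eq[OF h] \<rho>_outside by force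
      moreover have "waiting (P N h) x = 0" using w h(1) by blast
      ultimately have "length (x j) - 1 = 0"
        using finite_P[OF h(1)] by (simp add: waiting_def)
      then show False using il ni i(1) by auto
    qed
  qed
  show "finite {x. \<forall>j. (j \<in> servers (Gt N) \<longrightarrow> x j \<in> ?B) \<and> (j \<notin> servers (Gt N) \<longrightarrow> x j = [])}"
    by (rule finite_set_of_finite_funs)
       (use load_balancing.finS[OF load_balancing_regular] load_balancing.finD[OF load_balancing_regular] in auto)
qed

text \<open>JIQ reaches a busy server only when the whole pool of the task is busy; the union bound
  over classes does the rest.\<close>

lemma queueing_prob_le_sum:
  assumes "set_pmf \<pi> \<subseteq> states (Gt N)"
  shows "queueing_prob (Gt N) (jiq (pool N)) \<pi>
    \<le> (\<Sum>h=1..H. measure_pmf.prob \<pi> {x. idle_count (P N h) x = 0})"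
proof -
  interpret load_balancing "Gt N" "jiq (pool N)" by (rule load_balancing_regular)
  have "queueing_prob (Gt N) (jiq (pool N)) \<pi>
      \<le> measure_pmf.prob \<pi> (\<Union>h\<in>{1..H}. {x. idle_count (P N h) x = 0})"
  proof (rule queueing_prob_le)
    fix x i j assume i: "i \<in> dispatchers (Gt N)" and j: "j \<in> set_pmf (jiq (pool N) i x)" "busy x j"
    have "i \<in> dispatchers (G N)" using i by (simp add: icrd_def)
    then obtain h where h: "h \<in> {1..H}" "i \<in> D N h" by (rule disp_class_exists)
    have "\<forall>j\<in>P N h. busy x j"
      using j set_pmf_jiq[of "pool N" i x] finite_P[OF h(1)] P_nonempty[OF h(1)]
      unfolding pool_eq[OF h] by (auto split: if_splits)
    then have "idle_count (P N h) x = 0"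
      using idle_count_eq_0[OF finite_P[OF h(1)]] by blast
    then show "x \<in> (\<Union>h\<in>{1..H}. {x. idle_count (P N h) x = 0})"
      using h(1) by blast
  qed
  also have "\<dots> \<le> (\<Sum>h=1..H. measure_pmf.prob \<pi> {x. idle_count (P N h) x = 0})"
    by (rule measure_pmf.finite_measure_subadditive_finite) auto
  finally show ?thesis .
qed

end

section \<open>Drift bounds uniform in \<open>N\<close>, and the conclusion\<close>

lemma \<rho>_range:
  "\<exists>\<rho>min \<rho>max. 0 < \<rho>min \<and> 0 < \<rho>max \<and> (\<forall>N h j. regular N \<longrightarrow> h \<in> {1..H} \<longrightarrow> j \<in> P N h \<longrightarrow>
    \<rho>min \<le> \<rho> N h j \<and> \<rho> N h j \<le> \<rho>max)"
proof -
  \<comment> \<open>All rates on the pools come from the finite array of \<mu>, whatever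
    \<open>N\<close> is. Keeping its positive entries makes the minimum positive, and the element 1
    makes the set nonempty.\<close>
  let ?A = "insert 1 ((\<lambda>(h, m). \<mu> h m) ` ({1..H} \<times> {1..M}) \<inter> {0<..})"
  have "finite ?A" by auto
  moreover have "\<rho> N h j \<in> ?A" if prems: "regular N" "h \<in> {1..H}" "j \<in> P N h" for N h j
  proof -
    obtain m where m: "m \<in> {1..M}" "j \<in> S N h m" using prems(3) by (auto simp: P_def)
    have "divided N" using prems(1) by (simp add: regular_def)
    then show ?thesis
      using \<rho>_eq[of N h m j] S_\<mu>_pos[of N h m j] prems(2) m by force
  qed
  moreover have "0 < Min ?A" by (subst Min_gr_iff) auto
  moreover have "0 < Max ?A" by (subst Max_gr_iff) auto
  ultimately show ?thesis
    by (intro exI[of _ "Min ?A"] exI[of _ "Max ?A"] conjI allI impI Min_le Max_ge) blast+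
qed

text \<open>The constants are chosen before \<eta>: existence of a steady state needs \<eta> small
  against \<beta>, whereas the queueing bound takes \<open>\<eta> = 1\<close>.\<close>

lemma drift_exists:
  "\<exists>r \<kappa> \<beta>. (\<forall>h\<in>{1..H}. 0 < r h \<and> r h < 1) \<and> 0 < \<kappa> \<and> 0 < \<beta> \<and>
    (\<forall>\<eta>>0. \<forall>\<^sub>F N in sequentially. regular N \<and> (\<forall>h\<in>{1..H}. \<forall>x\<in>states (Gt N).
       generator (Gt N) (jiq (pool N)) (lyapunov (r h) (P N h)) x
         \<le> \<eta> - \<kappa> * real N * of_bool (idle_count (P N h) x = 0) \<and>
       generator (Gt N) (jiq (pool N)) (lyapunov (r h) (P N h)) x
         \<le> \<eta> - \<beta> * of_bool (waiting (P N h) x \<noteq> 0)))"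
proof -
  obtain \<rho>min \<rho>max where \<rho>m: "0 < \<rho>min" "0 < \<rho>max"
    "\<And>N h j. regular N \<Longrightarrow> h \<in> {1..H} \<Longrightarrow> j \<in> P N h \<Longrightarrow> \<rho>min \<le> \<rho> N h j \<and> \<rho> N h j \<le> \<rho>max"
    using \<rho>_range by blast
  have "\<forall>h\<in>{1..H}. \<exists>r \<kappa>. 0 < r \<and> r < 1 \<and> 0 < \<kappa> \<and> (\<forall>\<^sub>F N in sequentially.
    (\<Sum>i\<in>D N h. arr_rate (G N) i) / r + \<kappa> * real N \<le> (\<Sum>j\<in>P N h. \<rho> N h j))"
    by (intro ballI load_exists)
  from bchoice[OF this] obtain r where "\<forall>h\<in>{1..H}. \<exists>\<kappa>. 0 < r h \<and> r h < 1 \<and> 0 < \<kappa> \<and> (\<forall>\<^sub>F N in sequentially.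
    (\<Sum>i\<in>D N h. arr_rate (G N) i) / r h + \<kappa> * real N \<le> (\<Sum>j\<in>P N h. \<rho> N h j))"
    ..
  from bchoice[OF this] obtain \<kappa> where \<kappa>r: "\<forall>h\<in>{1..H}. 0 < r h \<and> r h < 1 \<and> 0 < \<kappa> h \<and> (\<forall>\<^sub>F N in sequentially.
    (\<Sum>i\<in>D N h. arr_rate (G N) i) / r h + \<kappa> h * real N \<le> (\<Sum>j\<in>P N h. \<rho> N h j))"
    ..
  then have r: "\<And>h. h \<in> {1..H} \<Longrightarrow> 0 < r h \<and> r h < 1"
    and \<kappa>: "\<And>h. h \<in> {1..H} \<Longrightarrow> 0 < \<kappa> h"
    and load: "\<And>h. h \<in> {1..H} \<Longrightarrow> \<forall>\<^sub>F N in sequentially.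
      (\<Sum>i\<in>D N h. arr_rate (G N) i) / r h + \<kappa> h * real N \<le> (\<Sum>j\<in>P N h. \<rho> N h j)"
    by simp_all
  define \<kappa>0 where "\<kappa>0 = Min (\<kappa> ` {1..H})"
  define \<beta> where "\<beta> = Min ((\<lambda>h. (1 - r h) * \<rho>min) ` {1..H})"
  have \<kappa>0: "0 < \<kappa>0" "\<And>h. h \<in> {1..H} \<Longrightarrow> \<kappa>0 \<le> \<kappa> h"
    using \<kappa> H_pos unfolding \<kappa>0_def by (auto simp: Min_gr_iff)
  have \<beta>: "0 < \<beta>" "\<And>h. h \<in> {1..H} \<Longrightarrow> \<beta> \<le> (1 - r h) * \<rho>min"
    using r \<rho>m(1) H_pos unfolding \<beta>_def by (auto simp: Min_gr_iff)
  show ?thesis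
  proof (rule exI[of _ r], rule exI[of _ \<kappa>0], rule exI[of _ \<beta>], intro conjI allI impI \<kappa>0(1) \<beta>(1))
    show "\<forall>h\<in>{1..H}. 0 < r h \<and> r h < 1" using r by blast
    fix \<eta> :: real assume \<eta>: "0 < \<eta>"
    \<comment> \<open>The surplus \<open>\<kappa> h * real N\<close> plays the role of
      \<open>d\<close> and tends to infinity.\<close>
    have small: "\<forall>\<^sub>F N in sequentially. \<forall>n. r h ^ n * (\<rho>max * real n - \<kappa> h * real N) \<le> \<eta>"
      if h: "h \<in> {1..H}" for h
    proof -
      have "filterlim (\<lambda>N. \<kappa> h * real N) at_top sequentially" using \<kappa>[OF h] by real_asymp
      then show ?thesis
        using power_times_affine_small[of "r h" \<eta> \<rho>max] r[OF h] \<eta> \<rho>m(2)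
        by (auto simp: filterlim_iff)
    qed
    have large: "\<forall>\<^sub>F N in sequentially. (1 - r h) * \<rho>min \<le> \<kappa> h * real N" if h: "h \<in> {1..H}" for h
      using \<kappa>[OF h] by real_asymp
    have "\<forall>\<^sub>F N in sequentially. regular N \<and> (\<forall>h\<in>{1..H}.
        (\<Sum>i\<in>D N h. arr_rate (G N) i) / r h + \<kappa> h * real N \<le> (\<Sum>j\<in>P N h. \<rho> N h j) \<and>
        (\<forall>n. r h ^ n * (\<rho>max * real n - \<kappa> h * real N) \<le> \<eta>) \<and>
        (1 - r h) * \<rho>min \<le> \<kappa> h * real N)"
      by (intro eventually_conj eventually_regular eventually_ball_finite ballI load small large) auto
    then show "\<forall>\<^sub>F N in sequentially. regular N \<and> (\<forall>h\<in>{1..H}. \<forall>x\<in>states (Gt N).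
       generator (Gt N) (jiq (pool N)) (lyapunov (r h) (P N h)) x
         \<le> \<eta> - \<kappa>0 * real N * of_bool (idle_count (P N h) x = 0) \<and>
       generator (Gt N) (jiq (pool N)) (lyapunov (r h) (P N h)) x
         \<le> \<eta> - \<beta> * of_bool (waiting (P N h) x \<noteq> 0))"
    proof eventually_elim
      case (elim N)
      show ?case
      proof (intro conjI ballI)
        show reg: "regular N" using elim by blast
        fix h x assume h: "h \<in> {1..H}" and x: "x \<in> states (Gt N)"
        interpret jiq_class "Gt N" "pool N" "D N h" "P N h" "\<rho> N h"
          by (rule jiq_class_regular[OF reg h])
        have arr: "arr_rate (Gt N) = arr_rate (G N)" by (simp add: icrd_def)
        have le: "generator (Gt N) (jiq (pool N)) (lyapunov (r h) (P N h)) x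
             \<le> \<eta> - \<kappa> h * real N * of_bool (idle_count (P N h) x = 0)"
          "generator (Gt N) (jiq (pool N)) (lyapunov (r h) (P N h)) x
             \<le> \<eta> - (1 - r h) * \<rho>min * of_bool (waiting (P N h) x \<noteq> 0)"
          using generator_lyapunov_le[OF x, of "r h" \<rho>min \<rho>max "\<kappa> h * real N" \<eta>]
            r[OF h] \<rho>m(1) \<rho>m(3)[OF reg h] elim h \<eta> arr by auto
        show "generator (Gt N) (jiq (pool N)) (lyapunov (r h) (P N h)) x
           \<le> \<eta> - \<kappa>0 * real N * of_bool (idle_count (P N h) x = 0)"
          using le(1) mult_right_mono[OF \<kappa>0(2)[OF h], of "real N"]
          by (cases "idle_count (P N h) x = 0") auto
        show "generator (Gt N) (jiq (pool N)) (lyapunov (r h) (P N h)) x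
           \<le> \<eta> - \<beta> * of_bool (waiting (P N h) x \<noteq> 0)"
          using le(2) \<beta>(2)[OF h] by (cases "waiting (P N h) x = 0") auto
      qed
    qed
  qed
qed

lemma steady_state_eventually: "\<forall>\<^sub>F N in sequentially. \<exists>\<pi>. steady_state (Gt N) (jiq (pool N)) \<pi>"
proof -
  obtain r \<kappa> \<beta> where r: "\<forall>h\<in>{1..H}. 0 < r h \<and> r h < 1" and \<beta>: "0 < \<beta>"
    and drift: "\<forall>\<eta>>0. \<forall>\<^sub>F N in sequentially. regular N \<and> (\<forall>h\<in>{1..H}. \<forall>x\<in>states (Gt N).
       generator (Gt N) (jiq (pool N)) (lyapunov (r h) (P N h)) x
         \<le> \<eta> - \<kappa> * real N * of_bool (idle_count (P N h) x = 0) \<and>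
       generator (Gt N) (jiq (pool N)) (lyapunov (r h) (P N h)) x
         \<le> \<eta> - \<beta> * of_bool (waiting (P N h) x \<noteq> 0))"
    using drift_exists by blast
  \<comment> \<open>With this choice of \<eta> the errors of the \<open>H\<close> classes add up to
    \<open>\<beta> / 2\<close>, which stays below \<beta>.\<close>
  have "0 < \<beta> / (2 * real H)" using \<beta> H_pos by simp
  from drift[rule_format, OF this] show ?thesis
  proof eventually_elim
    case (elim N)
    then have reg: "regular N" by blast
    interpret load_balancing "Gt N" "jiq (pool N)" by (rule load_balancing_regular[OF reg])
    let ?V = "\<lambda>x. \<Sum>h\<in>{1..H}. lyapunov (r h) (P N h) x"
    let ?F = "{x \<in> states (Gt N). \<forall>h\<in>{1..H}. waiting (P N h) x = 0}"
    show ?case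
    proof (rule steady_state_exists[where V="?V" and F="?F"
          and L="\<Sum>h\<in>{1..H}. - 1 / (1 - r h)" and b="\<beta> / 2" and c=\<beta>])
      show "(\<Sum>h\<in>{1..H}. - 1 / (1 - r h)) \<le> ?V x" for x
        using r lyapunov_lower by (intro sum_mono) blast
      show "finite ?F" by (rule finite_nonwaiting[OF reg])
      fix x assume x: "x \<in> states (Gt N)"
      have "generator (Gt N) (jiq (pool N)) ?V x
          = (\<Sum>h\<in>{1..H}. generator (Gt N) (jiq (pool N)) (lyapunov (r h) (P N h)) x)"
        by (rule generator_sum) (rule fin_policy)
      also have "\<dots> \<le> (\<Sum>h\<in>{1..H}. \<beta> / (2 * real H) - \<beta> * of_bool (waiting (P N h) x \<noteq> 0))"
        using elim x by (intro sum_mono) blast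
      also have "\<dots> = \<beta> / 2 - \<beta> * (\<Sum>h\<in>{1..H}. of_bool (waiting (P N h) x \<noteq> 0))"
        using H_pos by (simp add: sum_subtractf sum_distrib_left del: sum_of_bool_eq)
      also have "\<dots> \<le> \<beta> / 2 - \<beta> * indicator (- ?F) x"
      proof -
        have "indicator (- ?F) x \<le> (\<Sum>h\<in>{1..H}. of_bool (waiting (P N h) x \<noteq> 0) :: real)"
        proof (cases "x \<in> ?F")
          case False
          then obtain h where h: "h \<in> {1..H}" "waiting (P N h) x \<noteq> 0" using x by auto
          have "of_bool (waiting (P N h) x \<noteq> 0)
              \<le> (\<Sum>h\<in>{1..H}. of_bool (waiting (P N h) x \<noteq> 0) :: real)"
            using h by (intro member_le_sum) auto
          then show ?thesis using h False by simp
        qed (auto intro!: sum_nonneg simp del: sum_of_bool_eq)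
        then show ?thesis using \<beta> by (simp del: sum_of_bool_eq)
      qed
      finally show "generator (Gt N) (jiq (pool N)) ?V x \<le> \<beta> / 2 - \<beta> * indicator (- ?F) x" .
    qed (use \<beta> in auto)
  qed
qed

lemma queueing_prob_tendsto_0:
  assumes st: "\<forall>\<^sub>F N in sequentially. steady_state (Gt N) (jiq (pool N)) (\<pi> N)"
  shows "(\<lambda>N. queueing_prob (Gt N) (jiq (pool N)) (\<pi> N)) \<longlonglongrightarrow> 0"
proof -
  obtain r \<kappa> \<beta> where r: "\<forall>h\<in>{1..H}. 0 < r h \<and> r h < 1" and \<kappa>: "0 < \<kappa>"
    and drift: "\<forall>\<eta>>0. \<forall>\<^sub>F N in sequentially. regular N \<and> (\<forall>h\<in>{1..H}. \<forall>x\<in>states (Gt N).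
       generator (Gt N) (jiq (pool N)) (lyapunov (r h) (P N h)) x
         \<le> \<eta> - \<kappa> * real N * of_bool (idle_count (P N h) x = 0) \<and>
       generator (Gt N) (jiq (pool N)) (lyapunov (r h) (P N h)) x
         \<le> \<eta> - \<beta> * of_bool (waiting (P N h) x \<noteq> 0))"
    using drift_exists by blast
  \<comment> \<open>With \<open>\<eta> = 1\<close> each pool is fully busy with probability at most
    \<open>1 / (\<kappa> * real N)\<close>, and there are \<open>H\<close> pools.\<close>
  have upper: "\<forall>\<^sub>F N in sequentially. queueing_prob (Gt N) (jiq (pool N)) (\<pi> N) \<le> real H / (\<kappa> * real N)"
    using drift[rule_format, OF zero_less_one] st eventually_gt_at_top[of 0]
  proof eventually_elim
    case (elim N)
    then have reg: "regular N" by blast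
    interpret load_balancing "Gt N" "jiq (pool N)" by (rule load_balancing_regular[OF reg])
    have "measure_pmf.prob (\<pi> N) {x. idle_count (P N h) x = 0} \<le> 1 / (\<kappa> * real N)"
      if h: "h \<in> {1..H}" for h
    proof -
      have "\<kappa> * real N * measure_pmf.prob (\<pi> N) {x. idle_count (P N h) x = 0} \<le> 1"
      proof (rule steady_state_prob_bound[OF elim(2), where V="lyapunov (r h) (P N h)"])
        show "- 1 / (1 - r h) \<le> lyapunov (r h) (P N h) x" for x
          using lyapunov_lower r h by blast
        show "generator (Gt N) (jiq (pool N)) (lyapunov (r h) (P N h)) x
            \<le> 1 - \<kappa> * real N * indicator {x. idle_count (P N h) x = 0} x"
          if "x \<in> states (Gt N)" for x
          using elim h that by (auto simp: indicator_def)
      qed simp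
      then show ?thesis using \<kappa> elim by (simp add: pos_le_divide_eq mult.commute)
    qed
    then have "(\<Sum>h=1..H. measure_pmf.prob (\<pi> N) {x. idle_count (P N h) x = 0})
        \<le> (\<Sum>h=1..H. 1 / (\<kappa> * real N))"
      by (rule sum_mono)
    moreover have "set_pmf (\<pi> N) \<subseteq> states (Gt N)" using elim by (simp add: steady_state_def)
    ultimately show ?case using queueing_prob_le_sum[OF reg] by fastforce
  qed
  have lower: "\<forall>\<^sub>F N in sequentially. 0 \<le> queueing_prob (Gt N) (jiq (pool N)) (\<pi> N)"
    by (simp add: queueing_prob_def)
  have "(\<lambda>N. real H / (\<kappa> * real N)) \<longlonglongrightarrow> 0" using \<kappa> by real_asymp
  from tendsto_sandwich[OF lower upper tendsto_const this] show ?thesis .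
qed

end

text \<open>The first conjunct keeps the second from being vacuous; the second covers every choice
  of stationary laws.\<close>

theorem corollary3p3:
  fixes f :: "real \<Rightarrow> real \<Rightarrow> real"
    and \<phi>1 \<phi>2 :: "nat \<Rightarrow> real"
    and G :: "nat \<Rightarrow> lb_system"
    and H M :: nat
    and w v :: "nat \<Rightarrow> real"
    and \<mu> :: "nat \<Rightarrow> nat \<Rightarrow> real"
    and \<Lambda> :: "nat \<Rightarrow> real"
    and p \<epsilon> :: "nat \<Rightarrow> nat \<Rightarrow> real"
    and S :: "nat \<Rightarrow> nat \<Rightarrow> nat \<Rightarrow> nat set"
  defines "Gt \<equiv> \<lambda>N. icrd \<phi>1 H w M \<mu> (G N) (S N)"
    and "JIQ \<equiv> \<lambda>N. jiq (icrd_pool \<phi>1 H w M (G N) (S N))"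
  assumes "f_sequence f \<phi>1 \<phi>2 G"
    and "stepwise f H w M v \<mu>"
    and "subcritical \<phi>1 \<phi>2 G H w M v \<mu> \<Lambda> p"
    and "\<epsilon> \<in> icrd_Poly H M v \<mu> \<Lambda> p"
    and "\<forall>\<^sub>F N in sequentially. icrd_division \<phi>2 H M v \<mu> \<Lambda> p \<epsilon> N (G N) (S N)"
  shows "(\<forall>\<^sub>F N in sequentially. \<exists>\<pi>. steady_state (Gt N) (JIQ N) \<pi>) \<and>
    (\<forall>\<pi>. (\<forall>\<^sub>F N in sequentially. steady_state (Gt N) (JIQ N) (\<pi> N)) \<longrightarrow>
       (\<lambda>N. queueing_prob (Gt N) (JIQ N) (\<pi> N)) \<longlonglongrightarrow> 0)"
proof -
  interpret icrd_setting f \<phi>1 \<phi>2 G H M w v \<mu> \<Lambda> p \<epsilon> S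
    using assms(3-) by unfold_locales
  show ?thesis
    unfolding Gt_def JIQ_def using steady_state_eventually queueing_prob_tendsto_0 by blast
qed

end
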